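(* Let $n\ge7$ and let $(u_\lambda)$ be a family of least energy radial sign-changing solutions of $$-\Delta u=\lambda u+|u|^{2^*-2}u \ \text{ in } B_1,\qquad u=0\ \text{ on }\partial B_1,$$ with $u_\lambda(0)>0$. Let $\epsilon\in(0,\frac{n-2}{2})$. There exist $h=h(\epsilon)$ and $\bar\lambda=\bar\lambda(\epsilon)>0$ such that $$\tilde u_\lambda^-(y)\le U_h(y)\quad\text{for all } y\in\mathbb{R}^n,\ 0<\lambda<\bar\lambda,$$ where $$U_h(y):=\begin{cases}1&\text{if }|y|\le h,\\ \left[1+\frac{1}{n(n-2)}c(\epsilon)|y|^2\right]^{-(n-2)/2}&\text{if }|y|>h,\end{cases}$$ with $c(\epsilon)=\frac{2}{n-2}\epsilon$.
   Context: $B_1$ is the open unit ball of $\mathbb{R}^n$, $2^*=\frac{2n}{n-2}$, $\beta:=\frac2{n-2}$, and $\lambda_1$ is the first Dirichlet eigenvalue of $-\Delta$ in $B_1$. A least energy radial sign-changing solution is a radial sign-changing solution minimizing $I_\lambda(u)=\frac12\int_{B_1}(|\nabla u|^2-\lambda u^2)\,dx-\frac1{2^*}\int_{B_1}|u|^{2^*}dx$ among all radial sign-changing solutions of the problem with parameter $\lambda$. The family consists of one such solution $u_\lambda$ for each $\lambda\in(0,\lambda_1)$. Solutions are classical. Each $u_\lambda$ has exactly two nodal regions: there is a node $r_\lambda\in(0,1)$ with $u_\lambda>0$ in $\{|x|<r_\lambda\}$ and $u_\lambda<0$ in $\{r_\lambda<|x|<1\}$. Moreover $u_\lambda^-=\max(-u_\lambda,0)$,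 $M_{\lambda,-}:=\|u_\lambda^-\|_\infty$, and $\tilde u_\lambda^-(y):=\frac{1}{M_{\lambda,-}}u_\lambda^-\big(\frac{y}{M_{\lambda,-}^\beta}\big)$ for $M_{\lambda,-}^\beta r_\lambda<|y|<M_{\lambda,-}^\beta$, extended by zero to all of $\mathbb{R}^n$. *)

theory Defs
  imports "HOL-Analysis.Analysis"
begin

definition gradient :: "(real^'n \<Rightarrow> real) \<Rightarrow> real^'n \<Rightarrow> real^'n" where
  "gradient f x = (THE D. GDERIV f x :> D)"

definition hessian :: "(real^'n \<Rightarrow> real) \<Rightarrow> real^'n \<Rightarrow> real^'n^'n" where
  "hessian f x = jacobian (gradient f) (at x)"

definition laplacian :: "(real^'n \<Rightarrow> real) \<Rightarrow> real^'n \<Rightarrow> real" where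
  "laplacian f x = trace (hessian f x)"

(* Intended for open S only. *)
definition C2_on :: "(real^'n) set \<Rightarrow> (real^'n \<Rightarrow> real) \<Rightarrow> bool" where
  "C2_on S f \<longleftrightarrow>
     (\<forall>x\<in>S. f differentiable (at x)) \<and>
     (\<forall>x\<in>S. gradient f differentiable (at x)) \<and>
     continuous_on S (hessian f)"

(* u is a classical solution, in C^2(S) and C^0(closure S), of
   -Laplace u = F(u) in S with u = 0 on the boundary of S. *)
definition dirichlet_solution ::
    "(real^'n) set \<Rightarrow> (real \<Rightarrow> real) \<Rightarrow> (real^'n \<Rightarrow> real) \<Rightarrow> bool" where
  "dirichlet_solution S F u \<longleftrightarrow>
     C2_on S u \<and> continuous_on (closure S) u \<and>
     (\<forall>x\<in>S. - laplacian u x = F (u x)) \<and>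
     (\<forall>x\<in>frontier S. u x = 0)"

definition dirichlet_eigenvalue :: "(real^'n) set \<Rightarrow> real \<Rightarrow> bool" where
  "dirichlet_eigenvalue S \<mu> \<longleftrightarrow>
     (\<exists>\<phi>. dirichlet_solution S (\<lambda>t. \<mu> * t) \<phi> \<and> (\<exists>x\<in>S. \<phi> x \<noteq> 0))"

(* On the unit ball the classical eigenfunctions are all eigenfunctions, and the
   infimum is attained. *)
definition first_dirichlet_eigenvalue :: "(real^'n) set \<Rightarrow> real" where
  "first_dirichlet_eigenvalue S = Inf {\<mu>. dirichlet_eigenvalue S \<mu>}"

definition critical_exponent :: "nat \<Rightarrow> real" where
  "critical_exponent n = 2 * real n / (real n - 2)"

definition brezis_nirenberg_solution :: "real \<Rightarrow> (real^'n \<Rightarrow> real) \<Rightarrow> bool" where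
  "brezis_nirenberg_solution lam u \<longleftrightarrow>
     dirichlet_solution (ball 0 1)
       (\<lambda>t. lam * t + \<bar>t\<bar> powr (critical_exponent CARD('n) - 2) * t) u"

definition radial :: "(real^'n \<Rightarrow> real) \<Rightarrow> bool" where
  "radial u \<longleftrightarrow> (\<forall>x\<in>cball 0 1. \<forall>y\<in>cball 0 1. norm x = norm y \<longrightarrow> u x = u y)"

definition sign_changing :: "(real^'n \<Rightarrow> real) \<Rightarrow> bool" where
  "sign_changing u \<longleftrightarrow> (\<exists>x\<in>ball 0 1. u x > 0) \<and> (\<exists>x\<in>ball 0 1. u x < 0)"

(* Classical solutions on the unit ball have finite Dirichlet energy, so for them the
   integrals below are not the default value of a non-integrable function. *)
definition energy :: "real \<Rightarrow> (real^'n \<Rightarrow> real) \<Rightarrow> real" where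
  "energy lam u =
     1 / 2 * (LINT x:ball 0 1|lborel. (norm (gradient u x))\<^sup>2 - lam * (u x)\<^sup>2)
     - 1 / critical_exponent CARD('n)
         * (LINT x:ball 0 1|lborel. \<bar>u x\<bar> powr critical_exponent CARD('n))"

definition radial_sign_changing_solution :: "real \<Rightarrow> (real^'n \<Rightarrow> real) \<Rightarrow> bool" where
  "radial_sign_changing_solution lam u \<longleftrightarrow>
     brezis_nirenberg_solution lam u \<and> radial u \<and> sign_changing u"

definition least_energy_radial_sign_changing_solution ::
    "real \<Rightarrow> (real^'n \<Rightarrow> real) \<Rightarrow> bool" where
  "least_energy_radial_sign_changing_solution lam u \<longleftrightarrow>
     radial_sign_changing_solution lam u \<and>
     (\<forall>v :: real^'n \<Rightarrow> real. radial_sign_changing_solution lam v \<longrightarrow> energy lam u \<le> energy lam v)"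

(* u has exactly two nodal regions in the unit ball, separated by the sphere of
   radius r, and is positive in the inner one. *)
definition is_node :: "(real^'n \<Rightarrow> real) \<Rightarrow> real \<Rightarrow> bool" where
  "is_node u r \<longleftrightarrow>
     0 < r \<and> r < 1 \<and>
     (\<forall>x. norm x < r \<longrightarrow> u x > 0) \<and>
     (\<forall>x. r < norm x \<and> norm x < 1 \<longrightarrow> u x < 0)"

definition neg_part :: "(real^'n \<Rightarrow> real) \<Rightarrow> real^'n \<Rightarrow> real" where
  "neg_part u x = max (- u x) 0"

definition neg_sup_norm :: "(real^'n \<Rightarrow> real) \<Rightarrow> real" where
  "neg_sup_norm u = (SUP x\<in>ball 0 1. \<bar>neg_part u x\<bar>)"

definition rescaling_exponent :: "nat \<Rightarrow> real" where
  "rescaling_exponent n = 2 / (real n - 2)"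

definition rescaled_neg_part :: "(real^'n \<Rightarrow> real) \<Rightarrow> real \<Rightarrow> real^'n \<Rightarrow> real" where
  "rescaled_neg_part u r y =
     (let M = neg_sup_norm u; s = M powr rescaling_exponent CARD('n)
      in if s * r < norm y \<and> norm y < s then 1 / M * neg_part u (y /\<^sub>R s) else 0)"

definition barrier_coeff :: "nat \<Rightarrow> real \<Rightarrow> real" where
  "barrier_coeff n \<epsilon> = 2 / (real n - 2) * \<epsilon>"

definition barrier :: "real \<Rightarrow> real \<Rightarrow> real^'n \<Rightarrow> real" where
  "barrier \<epsilon> h y =
     (let n = CARD('n)
      in if norm y \<le> h then 1
         else (1 + 1 / (real n * (real n - 2)) * barrier_coeff n \<epsilon> * (norm y)\<^sup>2)
                powr (- (real n - 2) / 2))"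

end

(*
  Only the radial equation and the sign pattern of u are used. Write w for the negative part, M = w(s)
  for its maximum and sigma = M^(2/(n-2)) s for the rescaled radius of the maximum point.

  The Pohozaev function of u vanishes at 0 and has derivative lam t^(n-1) u^2. On (0, r) the equation
  gives u^2 <= C t^(2-n) with C independent of u, so at the node it is at most C lam / 2. On (r, s) it
  grows by at most lam M^2 s^n / n, while at s it is at least a multiple of sigma^n, and
  M^(4/(n-2)) >= 2n - lam because w vanishes on the unit sphere. Hence sigma is bounded as lam -> 0.

  To the right of s, a variant of the Pohozaev function is increasing. It controls the derivative of
  g'/t, where g = w^(-2/(n-2)), and integrating twice from s gives
  (w(t)/M)^(-2/(n-2)) >= 1 + (M^(4/(n-2)) t^2 - n sigma^2/(n-2)) / (n(n-2)).
  As sigma is bounded and c(epsilon) < 1, this is the barrier once h is large.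
*)
theory Submission
  imports Defs
begin

section \<open>Radial profiles\<close>

text \<open>The barrier has the shape of the standard bubble, for which w^(-2/(n-2)) is a quadratic
  polynomial in t and its derivative divided by t is constant. This singles out the power of w that
  is followed to the right of s. The obstacle is uniformity: neither u(0) nor M is bounded from
  above. The inner estimate therefore discards u(0), and the lower bound on M^(4/(n-2)) serves to
  absorb lam M^2 s^n / n into the multiple of sigma^n. The loss of order sigma^2 in the final
  inequality is paid for by the share 1 - c(epsilon) of |y|^2 that the barrier gives up. The
  threshold for lam must be positive and at most lambda_1. Since lambda_1 is an infimum of a set of
  reals, its positivity needs both an eigenvalue, obtained from a Bessel series, and a common
  positive lower bound for all of them. Integrations are carried out as monotonicity of a difference
  with an explicit antiderivative.\<close>

lemma DERIV_nonneg_imp_le_open: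
  fixes f :: "real \<Rightarrow> real"
  assumes "a \<le> b" and cont: "continuous_on {a..b} f"
    and deriv: "\<And>x. a < x \<Longrightarrow> x < b \<Longrightarrow> \<exists>y. (f has_real_derivative y) (at x) \<and> 0 \<le> y"
  shows "f a \<le> f b"
proof (cases "a < b")
  case True
  obtain l z where "a < z" "z < b" "(f has_real_derivative l) (at z)" "f b - f a = (b - a) * l"
    using MVT[OF True cont] deriv by (metis real_differentiable_def)
  moreover from this have "0 \<le> l"
    using deriv DERIV_unique by blast
  ultimately show ?thesis
    using True by (metis diff_ge_0_iff_ge mult_nonneg_nonneg less_imp_le)
next
  case False
  then show ?thesis using assms by simp
qed

text \<open>Keeping the exponent \<open>e\<close> and dividing by \<open>f x\<close>, instead of
  lowering the exponent, makes the power an opaque factor, so that later identities are rational and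
  accessible to \<open>field_simps\<close>.\<close>

lemma has_real_derivative_powr_of_pos:
  assumes "(f has_real_derivative d) (at x)" "0 < f x"
  shows "((\<lambda>t. f t powr e) has_real_derivative e * f x powr e / f x * d) (at x)"
  using DERIV_fun_powr[OF assms, of e] assms(2) by (simp add: powr_diff)

text \<open>With \<open>V = w\<close>, \<open>D = w'\<close>, \<open>X = w''\<close> and \<open>e = w powr (- 2 / k)\<close>, the left-hand side is the derivative
  of \<open>e' / y\<close> and the last factor on the right is the Pohozaev expression.\<close>
lemma quotient_identity:
  fixes k n e V D y T K l X :: real
  assumes nz: "k \<noteq> 0" "V \<noteq> 0" "y \<noteq> 0" "T \<noteq> 0" and n: "n = k + 2"
    and n0: "n \<noteq> 0"
    and X: "y * X = - (k + 1) * D - y * (l * V + K * V)"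
  shows "((- (2 / k) * (- (2 / k) * e / V * D) * D + X * (- (2 / k) * e)) * (V * y)
        - (- (2 / k) * e * D) * (D * y + 1 * V)) / ((V * y) * (V * y))
     = 4 * n / k\<^sup>2 * (e / V\<^sup>2) / (T * y ^ 3)
        * (T * y\<^sup>2 * D\<^sup>2 / 2 + k / 2 * (T * y) * V * D
          + T * y\<^sup>2 * (k / (2 * n) * (K * V\<^sup>2) + l * k / n / 2 * V\<^sup>2))" (is "?L = ?R")
proof -
  \<comment> \<open>\<open>T\<close> stands for \<open>t ^ m\<close> and cancels. The Pohozaev
    expression is \<open>k * T * y / (2 * n)\<close> times \<open>?N\<close>, so both sides reduce
    to the same multiple of \<open>?N\<close>.\<close>
  let ?N = "n / k * D\<^sup>2 * y + n * D * V + (l + K) * V\<^sup>2 * y"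
  have "(- (2 / k) * (- (2 / k) * e / V * D) * D + X * (- (2 / k) * e)) * (V * y)
        - (- (2 / k) * e * D) * (D * y + 1 * V)
      = 2 / k * e * (2 / k * D\<^sup>2 * y + D\<^sup>2 * y + D * V - V * (y * X))"
    using nz by (simp add: field_simps power2_eq_square)
  also have "2 / k * D\<^sup>2 * y + D\<^sup>2 * y + D * V - V * (y * X) = ?N"
    unfolding X n using nz by (simp add: field_simps power2_eq_square)
  finally have "?L = 2 / k * e * ?N / ((V * y) * (V * y))"
    by simp
  also have "\<dots> = ?R"
    using nz n0 by (simp add: field_simps power2_eq_square power3_eq_cube)
  finally show ?thesis .
qed

text \<open>The dimension is \<open>m + 2\<close>, so that \<open>2\<^sup>* - 2 = 4 / m\<close>.\<close>
locale critical_radial_profile =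
  fixes m :: nat and lam a b :: real and w w' :: "real \<Rightarrow> real"
  assumes m_ge: "2 \<le> m" and lam_pos: "0 < lam" and a_nonneg: "0 \<le> a" and a_less_b: "a < b"
    and cont: "continuous_on {a..b} w"
    and pos: "\<And>t. a < t \<Longrightarrow> t < b \<Longrightarrow> 0 < w t"
    and deriv: "\<And>t. a < t \<Longrightarrow> t < b \<Longrightarrow> (w has_real_derivative w' t) (at t)"
    and deriv2: "\<And>t. a < t \<Longrightarrow> t < b \<Longrightarrow>
      (w' has_real_derivative - (real m + 1) / t * w' t - lam * w t - w t powr (4 / m) * w t) (at t)"
begin

lemma nonneg:
  assumes "a \<le> t" "t \<le> b"
  shows "0 \<le> w t"
proof -
  have "closure {a<..<b} = {a..b}"
    using a_less_b by simp
  then show ?thesis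
    using continuous_ge_on_closure[of "{a<..<b}" w t 0] cont assms pos
    by (metis atLeastAtMost_iff greaterThanLessThan_iff less_imp_le)
qed

text \<open>The integrating factor \<open>t ^ (m + 1)\<close> puts the radial Laplacian in dimension
  \<open>m + 2\<close> into divergence form and removes the first-order term.\<close>

lemma flux_deriv:
  assumes "a < t" "t < b"
  shows "((\<lambda>t. t ^ (m + 1) * w' t) has_real_derivative
    - (t ^ (m + 1) * (lam * w t + w t powr (4 / m) * w t))) (at t)"
  by (rule DERIV_cong, (rule derivative_intros deriv2 assms)+)
    (use assms a_nonneg in \<open>simp add: field_simps\<close>)

text \<open>Nondecreasing for \<open>c = lam\<close>; for \<open>c = lam m / (m + 2)\<close> nondecreasing wherever \<open>w' \<le> 0\<close>.\<close>
definition pohozaev :: "real \<Rightarrow> real \<Rightarrow> real" where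
  "pohozaev c t = t ^ (m + 2) * (w' t)\<^sup>2 / 2 + real m / 2 * t ^ (m + 1) * w t * w' t
     + t ^ (m + 2) * (real m / (2 * (real m + 2)) * (w t powr (4 / m) * (w t)\<^sup>2) + c / 2 * (w t)\<^sup>2)"

text \<open>For \<open>c = lam\<close> this is the equation multiplied by
  \<open>t ^ (m + 2) * w' t + m / 2 * t ^ (m + 1) * w t\<close>. Another \<open>c\<close> adds
  \<open>(c - lam) / 2\<close> times the derivative of \<open>t ^ (m + 2) * (w t)^2\<close>.\<close>

lemma pohozaev_deriv:
  fixes t c :: real
  assumes t: "a < t" "t < b"
  shows "(pohozaev c has_real_derivative
    lam * t ^ (m + 1) * (w t)\<^sup>2
     + (c - lam) / 2 * ((real m + 2) * t ^ (m + 1) * (w t)\<^sup>2 + 2 * t ^ (m + 2) * w t * w' t)) (at t)"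
proof -
  have t0: "0 < t" using t a_nonneg by simp
  define K where "K = (\<lambda>t. w t powr (4 / m))"
  have K: "(K has_real_derivative 4 / m * K t / w t * w' t) (at t)"
    unfolding K_def by (intro has_real_derivative_powr_of_pos deriv pos t)
  define X where "X = - (real m + 1) / t * w' t - lam * w t - K t * w t"
  have w2: "(w' has_real_derivative X) (at t)"
    using deriv2[OF t] unfolding K_def X_def by simp
  note d1 = deriv[OF t]
  have d2: "((\<lambda>t. (w t)\<^sup>2) has_real_derivative 2 * w t * w' t) (at t)"
    using DERIV_power[OF d1, of 2] by (simp add: mult_ac)
  have d2': "((\<lambda>t. (w' t)\<^sup>2) has_real_derivative 2 * w' t * X) (at t)"
    using DERIV_power[OF w2, of 2] by (simp add: mult_ac)
  have p1: "((\<lambda>t. t ^ (m + 1)) has_real_derivative real (m + 1) * t ^ m) (at t)"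
    and p2: "((\<lambda>t. t ^ (m + 2)) has_real_derivative real (m + 2) * t ^ (m + 1)) (at t)"
    using DERIV_pow[of "m + 1" t UNIV] DERIV_pow[of "m + 2" t UNIV] by simp_all
  have "pohozaev c = (\<lambda>t. t ^ (m + 2) * (w' t)\<^sup>2 / 2 + real m / 2 * t ^ (m + 1) * w t * w' t
     + t ^ (m + 2) * (real m / (2 * (real m + 2)) * (K t * (w t)\<^sup>2) + c / 2 * (w t)\<^sup>2))"
    by (simp add: pohozaev_def fun_eq_iff K_def)
  moreover have "(\<dots> has_real_derivative
      (real (m + 2) * t ^ (m + 1) * (w' t)\<^sup>2 + 2 * w' t * X * t ^ (m + 2)) / 2
      + ((real m / 2 * (real (m + 1) * t ^ m)) * w t + w' t * (real m / 2 * t ^ (m + 1))) * w' t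
      + X * (real m / 2 * t ^ (m + 1) * w t)
      + (real (m + 2) * t ^ (m + 1) * (real m / (2 * (real m + 2)) * (K t * (w t)\<^sup>2) + c / 2 * (w t)\<^sup>2)
        + (real m / (2 * (real m + 2)) * (4 / m * K t / w t * w' t * (w t)\<^sup>2 + 2 * w t * w' t * K t)
           + c / 2 * (2 * w t * w' t)) * t ^ (m + 2))) (at t)" (is "(_ has_real_derivative ?D) _")
    by (rule DERIV_cong[OF DERIV_add[OF DERIV_add[
            OF DERIV_cdivide[OF DERIV_mult[OF p2 d2']] DERIV_mult[OF DERIV_mult[OF DERIV_cmult[OF p1] d1] w2]]
          DERIV_mult[OF p2 DERIV_add[OF DERIV_cmult[OF DERIV_mult[OF K d2]] DERIV_cmult[OF d2]]]]])
       (simp add: algebra_simps)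
  moreover have "?D = lam * t ^ (m + 1) * (w t)\<^sup>2
     + (c - lam) / 2 * ((real m + 2) * t ^ (m + 1) * (w t)\<^sup>2 + 2 * t ^ (m + 2) * w t * w' t)"
  proof -
    \<comment> \<open>Criticality enters here: the factors \<open>4 / m\<close> and \<open>2\<close>
      add up to \<open>2 * (m + 2) / m\<close>, which the coefficient in front cancels
      exactly.\<close>
    have e1: "real m / (2 * (real m + 2)) * (4 / m * K t / w t * w' t * (w t)\<^sup>2 + 2 * w t * w' t * K t)
       = K t * w t * w' t"
      using pos[OF t] m_ge by (simp add: power2_eq_square divide_simps) (simp add: algebra_simps)
    have e2: "real (m + 2) * t ^ (m + 1) * (real m / (2 * (real m + 2)) * (K t * (w t)\<^sup>2) + c / 2 * (w t)\<^sup>2)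
       = t ^ (m + 1) * (real m / 2 * (K t * (w t)\<^sup>2) + (real m + 2) * c / 2 * (w t)\<^sup>2)"
      using m_ge by (simp add: divide_simps) (simp add: algebra_simps)
    have X: "t * X = - (real m + 1) * w' t - t * (lam * w t + K t * w t)"
      using t0 unfolding X_def by (simp add: field_simps)
    define T where "T = t ^ m"
    have T: "t ^ (m + 1) = t * T" "t ^ (m + 2) = t * t * T" "t ^ m = T"
      by (simp_all add: T_def)
    have X2: "2 * w' t * X * (t * t * T) = 2 * w' t * t * T * (t * X)"
      "X * (real m / 2 * (t * T) * w t) = real m / 2 * T * w t * (t * X)"
      by simp_all
    show ?thesis
      unfolding e1 e2 T X2 X by (simp add: field_simps power2_eq_square)
  qed
  ultimately show ?thesis by simp
qed

text \<open>A positive exponent keeps the power continuous at an end of the interval where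
  \<open>w\<close> vanishes.\<close>

lemma continuous_on_profile_powr:
  assumes "0 < e" "continuous_on S w" "S \<subseteq> {a..b}"
  shows "continuous_on S (\<lambda>t. w t powr e)"
  using assms nonneg by (intro continuous_on_powr') (auto intro!: continuous_intros)

lemma continuous_on_pohozaev:
  assumes "S \<subseteq> {a..b}" "continuous_on S w'"
  shows "continuous_on S (pohozaev c)"
proof -
  have cw: "continuous_on S w"
    by (rule continuous_on_subset[OF cont assms(1)])
  have cp: "continuous_on S (\<lambda>t. w t powr (4 / m))"
    using m_ge by (intro continuous_on_profile_powr cw assms(1)) simp
  show ?thesis
    unfolding pohozaev_def[abs_def]
    by (intro continuous_on_add continuous_on_mult continuous_on_divide continuous_on_power
        continuous_on_const continuous_on_id cw cp assms(2)) (simp_all add: add_nonneg_eq_0_iff)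
qed

section \<open>Height-independent estimates on the inner nodal ball\<close>

lemma flux_bound_from_centre:
  assumes a0: "a = 0" and cont': "continuous_on {0..<b} w'" and t: "0 < t" "t < b"
  shows "w t powr (4 / m) * w t * t ^ (m + 2) / (m + 2) \<le> - (t ^ (m + 1) * w' t)"
proof -
  have sub: "{0..t} \<subseteq> {a..b}" "{0..t} \<subseteq> {0..<b}"
    using t a0 by auto
  note contw = continuous_on_subset[OF cont sub(1)] and contw' = continuous_on_subset[OF cont' sub(2)]
  \<comment> \<open>The flux is zero at the origin and decreases, because the source is
    positive.\<close>
  have w'_neg: "w' x \<le> 0" if x: "0 < x" "x < b" for x
  proof -
    have "{0..x} \<subseteq> {0..<b}" using x by auto
    then have "- (0 ^ (m + 1) * w' 0) \<le> - (x ^ (m + 1) * w' x)"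
    proof (intro DERIV_nonneg_imp_le_open[where f = "\<lambda>t. - (t ^ (m + 1) * w' t)"] continuous_intros
        continuous_on_subset[OF cont'])
      fix y assume "0 < y" "y < x"
      then have y: "a < y" "y < b" "0 < y" using x a0 by auto
      show "\<exists>d. ((\<lambda>t. - (t ^ (m + 1) * w' t)) has_real_derivative d) (at y) \<and> 0 \<le> d"
        using flux_deriv[OF y(1,2), THEN DERIV_minus] lam_pos pos[OF y(1,2)] y(3)
        by (intro exI conjI) auto
    qed (use x in auto)
    then have "x ^ (m + 1) * w' x \<le> x ^ (m + 1) * 0"
      by simp
    then show ?thesis
      using x by (metis mult_le_cancel_left_pos zero_less_power)
  qed
  \<comment> \<open>As \<open>w\<close> decreases, the source on \<open>(0, t)\<close> is at least
    its value at \<open>t\<close>; \<open>?H\<close> is the gap between the flux and the resulting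
    lower bound, with the linear source term dropped. It vanishes at \<open>0\<close>.\<close>
  let ?H = "\<lambda>t. - (t ^ (m + 1) * w' t) - w t powr (4 / m) * w t * t ^ (m + 2) / (m + 2)"
  have "?H 0 \<le> ?H t"
  proof (rule DERIV_nonneg_imp_le_open[where f = ?H])
    show "continuous_on {0..t} ?H"
      using m_ge by (intro continuous_intros contw contw' continuous_on_profile_powr sub) auto
    fix x assume x: "0 < x" "x < t"
    then have xb: "a < x" "x < b" using t a0 by auto
    let ?K = "w x powr (4 / m)"
    have D: "(?H has_real_derivative
        - (- (x ^ (m + 1) * (lam * w x + ?K * w x)))
        - (((4 / m * ?K / w x * w' x) * w x + w' x * ?K) * x ^ (m + 2) + real (m + 2) * x ^ (m + 1) * (?K * w x)) / (m + 2)) (at x)"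
      using DERIV_pow[of "m + 2" x UNIV]
      by (intro DERIV_diff DERIV_minus DERIV_cdivide DERIV_mult flux_deriv deriv has_real_derivative_powr_of_pos xb pos)
         simp
    have E: "- (- (x ^ (m + 1) * (lam * w x + ?K * w x)))
        - (((4 / m * ?K / w x * w' x) * w x + w' x * ?K) * x ^ (m + 2) + real (m + 2) * x ^ (m + 1) * (?K * w x)) / (m + 2)
      = x ^ (m + 1) * lam * w x + (- w' x) * ((4 / m + 1) * ?K * x ^ (m + 2) / (m + 2))"
      using pos[OF xb] m_ge by (simp add: divide_simps) (simp add: algebra_simps)
    have N: "0 \<le> x ^ (m + 1) * lam * w x + (- w' x) * ((4 / m + 1) * ?K * x ^ (m + 2) / (m + 2))"
      using w'_neg[of x] x xb pos[OF xb] lam_pos by (intro add_nonneg_nonneg mult_nonneg_nonneg) auto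
    show "\<exists>y. (?H has_real_derivative y) (at x) \<and> 0 \<le> y"
      by (rule exI, rule conjI, rule D) (use N in \<open>simp only: E\<close>)
  qed (use t in simp)
  then show ?thesis by simp
qed

text \<open>Divided by \<open>t ^ (m + 1) * w t powr (4 / m) * w t\<close>, the flux bound becomes a
  lower bound for the derivative of \<open>w t powr (- (4 / m))\<close> that is linear in
  \<open>t\<close>. It is integrated from the centre, and the result is raised to the power
  \<open>m / 2\<close>.\<close>

lemma power_decay_from_centre:
  assumes a0: "a = 0" and w0: "0 < w 0" and cont': "continuous_on {0..<b} w'" and t: "0 < t" "t < b"
  shows "(w t)\<^sup>2 * t ^ m \<le> (real m * (real m + 2) / 2) powr (m / 2)"
proof -
  have sub: "{0..t} \<subseteq> {a..b}"
    using t a0 by auto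
  note contw = continuous_on_subset[OF cont sub(1)]
  have m0: "0 < real m" using m_ge by simp
  let ?G = "\<lambda>t. w t powr (- (4 / m)) - 4 / m * t\<^sup>2 / (2 * (m + 2))"
  have "?G 0 \<le> ?G t"
  proof (rule DERIV_nonneg_imp_le_open[where f = ?G])
    have "w x \<noteq> 0" if "x \<in> {0..t}" for x
      using that w0 pos[of x] a0 t by (cases "x = 0") auto
    then show "continuous_on {0..t} ?G"
      by (intro continuous_intros contw) auto
    fix x assume x: "0 < x" "x < t"
    then have xb: "a < x" "x < b" using t a0 by auto
    have wx: "0 < w x" using pos[OF xb] .
    let ?K = "w x powr (4 / m)"
    have K: "0 < ?K" using wx by simp
    have D: "(?G has_real_derivative
        (- (4 / m)) * w x powr (- (4 / m)) / w x * w' x - 4 / m * (2 * x) / (2 * (m + 2))) (at x)"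
      using DERIV_pow[of 2 x UNIV]
      by (intro DERIV_diff DERIV_cdivide DERIV_cmult deriv has_real_derivative_powr_of_pos xb pos) simp
    have "(- k) * inverse K / v * w' x - k * (2 * x) / (2 * d) = k * (1 / (K * v)) * (- w' x - K * v * x / d)"
      if "K \<noteq> 0" "v \<noteq> 0" "d \<noteq> 0" for k K v d :: real
      using that by (simp add: field_simps)
    from this[of ?K "w x" "real m + 2" "4 / m"]
    have eq: "(- (4 / m)) * inverse ?K / w x * w' x - 4 / m * (2 * x) / (2 * (real m + 2))
       = 4 / m * (1 / (?K * w x)) * (- w' x - ?K * w x * x / (real m + 2))"
      using wx K m0 by linarith
    have "?K * w x * x / (real m + 2) \<le> - w' x"
    proof -
      have "x ^ (m + 1) * (?K * w x * x / (m + 2)) \<le> x ^ (m + 1) * (- w' x)"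
        using flux_bound_from_centre[OF a0 cont' x(1) xb(2)] by (simp add: algebra_simps)
      moreover have "0 < x ^ (m + 1)" using x by simp
      ultimately have "?K * w x * x / (m + 2) \<le> - w' x"
        by (rule mult_le_cancel_left_pos[THEN iffD1, rotated])
      then show ?thesis by (simp add: add.commute)
    qed
    then have "0 \<le> 4 / m * (1 / (?K * w x)) * (- w' x - ?K * w x * x / (real m + 2))"
      using m0 K wx by (intro mult_nonneg_nonneg) auto
    then have N: "0 \<le> (- (4 / m)) * w x powr (- (4 / m)) / w x * w' x - 4 / m * (2 * x) / (2 * (m + 2))"
      unfolding eq[symmetric] powr_minus by (simp only: of_nat_add of_nat_mult of_nat_numeral)
    show "\<exists>y. (?G has_real_derivative y) (at x) \<and> 0 \<le> y"
      by (rule exI, rule conjI, rule D) (rule N)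
  qed (use t in simp)
  \<comment> \<open>Only the sign of \<open>?G 0\<close>, which is a negative power of
    \<open>w 0\<close>, is kept; this frees the constant from the height at the centre.\<close>
  moreover have "0 \<le> ?G 0"
    by simp
  ultimately have "0 \<le> ?G t"
    by linarith
  then have "4 / m * t\<^sup>2 / (2 * (m + 2)) \<le> w t powr (- (4 / m))"
    by linarith
  moreover have "4 / k * x / (2 * d) = 2 * x / (k * d)" if "k \<noteq> 0" "d \<noteq> 0" for k d x :: real
    using that by (simp add: field_simps)
  from this[of "real m" "real (m + 2)" "t\<^sup>2"]
  have "4 / real m * t\<^sup>2 / (2 * real (m + 2)) = 2 * t\<^sup>2 / (real m * real (m + 2))"
    using m0 by simp
  ultimately have *: "2 * t\<^sup>2 / (m * (m + 2)) \<le> 1 / w t powr (4 / m)"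
    unfolding powr_minus_divide of_nat_mult of_nat_numeral by simp
  have wt: "0 < w t" using pos t a0 by simp
  have "w t powr (4 / m) * t\<^sup>2 \<le> m * (m + 2) / 2"
  proof -
    have "K * x \<le> P / 2" if "2 * x / P \<le> 1 / K" "0 < P" "0 < K" for x P K :: real
      using that by (simp add: field_simps)
    from this[OF *] show ?thesis using wt m0 by (simp add: add_pos_pos)
  qed
  then have "(w t powr (4 / m) * t\<^sup>2) powr (m / 2) \<le> (m * (m + 2) / 2) powr (m / 2)"
    using wt t by (intro powr_mono2) auto
  moreover have "(w t powr (4 / m) * t\<^sup>2) powr (m / 2) = (w t)\<^sup>2 * t ^ m"
  proof -
    have "(w t powr (4 / m)) powr (m / 2) = (w t)\<^sup>2"
      using m0 wt by (simp add: powr_powr powr_numeral)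
    moreover have "(t\<^sup>2) powr (m / 2) = t ^ m"
      using t by (simp add: powr_powr powr_realpow flip: powr_numeral)
    ultimately show ?thesis using wt t by (simp add: powr_mult)
  qed
  ultimately show ?thesis by (simp only: of_nat_mult of_nat_add of_nat_numeral)
qed

text \<open>Both end values are explicit: the Pohozaev function vanishes at the origin through its
  powers of \<open>t\<close>, and where \<open>w\<close> vanishes only the slope term
  survives.\<close>

lemma boundary_slope_bound:
  assumes a0: "a = 0" and w0: "0 < w 0" and cont': "continuous_on {0..b} w'" and wb: "w b = 0"
  shows "b ^ (m + 2) * (w' b)\<^sup>2 \<le> lam * (real m * (real m + 2) / 2) powr (m / 2) * b\<^sup>2"
proof -
  let ?C = "(real m * (real m + 2) / 2) powr (m / 2)"
  have cont'': "continuous_on {0..<b} w'"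
    by (rule continuous_on_subset[OF cont']) auto
  let ?J = "\<lambda>t. lam * ?C * t\<^sup>2 / 2 - pohozaev lam t"
  have "?J 0 \<le> ?J b"
  proof (rule DERIV_nonneg_imp_le_open[where f = ?J])
    show "continuous_on {0..b} ?J"
      using a0 by (intro continuous_intros continuous_on_pohozaev cont') auto
    fix x assume x: "0 < x" "x < b"
    then have xa: "a < x" using a0 by simp
    have "(?J has_real_derivative lam * ?C * (2 * x) / 2 - (lam * x ^ (m + 1) * (w x)\<^sup>2
       + (lam - lam) / 2 * ((real m + 2) * x ^ (m + 1) * (w x)\<^sup>2 + 2 * x ^ (m + 2) * w x * w' x))) (at x)"
      using DERIV_pow[of 2 x UNIV]
      by (intro DERIV_diff DERIV_cdivide DERIV_cmult pohozaev_deriv xa x) simp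
    moreover have "x * ((w x)\<^sup>2 * x ^ m) \<le> x * ?C"
      using power_decay_from_centre[OF a0 w0 cont'' x] x(1) by (intro mult_left_mono) simp_all
    then have "lam * x ^ (m + 1) * (w x)\<^sup>2 \<le> lam * ?C * x"
      using lam_pos by (simp add: mult_ac)
    ultimately show "\<exists>y. (?J has_real_derivative y) (at x) \<and> 0 \<le> y"
      by (intro exI conjI) auto
  qed (use a_less_b a0 in simp)
  then show ?thesis
    using wb by (simp add: pohozaev_def)
qed

section \<open>Estimates on both sides of the maximum point\<close>

context
  fixes s :: real
  assumes s: "a < s" "s < b" and peak: "w' s = 0"
    and max: "\<And>t. a \<le> t \<Longrightarrow> t \<le> b \<Longrightarrow> w t \<le> w s"
begin

lemma peak_pos: "0 < w s"
  using pos s by simp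

lemma peak_pohozaev:
  assumes wa: "w a = 0" and cont': "continuous_on {a..<b} w'"
  shows "s ^ (m + 2) * (real m / (2 * (real m + 2)) * (w s powr (4 / m) * (w s)\<^sup>2))
    \<le> a ^ (m + 2) * (w' a)\<^sup>2 / 2 + lam * (w s)\<^sup>2 * s ^ (m + 2) / (m + 2)"
proof -
  let ?J = "\<lambda>t. lam * (w s)\<^sup>2 * t ^ (m + 2) / (m + 2) - pohozaev lam t"
  have "?J a \<le> ?J s"
  proof (rule DERIV_nonneg_imp_le_open[where f = ?J])
    show "continuous_on {a..s} ?J"
      using s by (intro continuous_intros continuous_on_pohozaev continuous_on_subset[OF cont']) auto
    fix x assume x: "a < x" "x < s"
    then have xb: "a < x" "x < b" and x0: "0 < x" using s a_nonneg by auto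
    have "(?J has_real_derivative lam * (w s)\<^sup>2 * (real (m + 2) * x ^ (m + 1)) / (m + 2)
       - (lam * x ^ (m + 1) * (w x)\<^sup>2
       + (lam - lam) / 2 * ((real m + 2) * x ^ (m + 1) * (w x)\<^sup>2 + 2 * x ^ (m + 2) * w x * w' x))) (at x)"
      using DERIV_pow[of "m + 2" x UNIV]
      by (intro DERIV_diff DERIV_cdivide DERIV_cmult pohozaev_deriv xb) simp
    moreover have "(w x)\<^sup>2 \<le> (w s)\<^sup>2"
      using max[of x] xb pos[OF xb] by (intro power_mono) auto
    then have "lam * x ^ (m + 1) * (w x)\<^sup>2 \<le> lam * x ^ (m + 1) * (w s)\<^sup>2"
      using lam_pos x0 by (intro mult_left_mono) auto
    ultimately show "\<exists>y. (?J has_real_derivative y) (at x) \<and> 0 \<le> y"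
      by (intro exI conjI) (auto simp: mult_ac)
  qed (use s in simp)
  \<comment> \<open>Two terms of favourable sign are discarded: the value of the majorant at
    \<open>a\<close> and the \<open>lam\<close> part of the Pohozaev function at
    \<open>s\<close>.\<close>
  moreover have "0 \<le> lam * (w s)\<^sup>2 * a ^ (m + 2) / (m + 2)" "0 \<le> s ^ (m + 2) * (lam / 2 * (w s)\<^sup>2)"
    using a_nonneg lam_pos s by auto
  ultimately show ?thesis
    using wa peak unfolding pohozaev_def by (simp add: distrib_left)
qed

lemma slope_nonpos_after_peak:
  assumes t: "s \<le> t" "t < b"
  shows "w' t \<le> 0"
proof -
  have "s ^ (m + 1) * w' s \<ge> t ^ (m + 1) * w' t"
  proof (rule DERIV_nonpos_imp_nonincreasing[where f = "\<lambda>t. t ^ (m + 1) * w' t"])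
    fix x assume x: "s \<le> x" "x \<le> t"
    then have xb: "a < x" "x < b" and x0: "0 < x" using s t a_nonneg by auto
    show "\<exists>d. ((\<lambda>t. t ^ (m + 1) * w' t) has_real_derivative d) (at x) \<and> d \<le> 0"
      using flux_deriv[OF xb] lam_pos pos[OF xb] x0 by (intro exI conjI) auto
  qed (use t in simp)
  then have "t ^ (m + 1) * w' t \<le> t ^ (m + 1) * 0"
    using peak by simp
  moreover have "0 < t ^ (m + 1)" using t s a_nonneg by simp
  ultimately show ?thesis
    by (rule mult_le_cancel_left_pos[THEN iffD1, rotated])
qed

text \<open>The flux starts at zero at the peak, and to its right the source is at most its value at
  the peak. Integrating the source from \<open>0\<close> instead of \<open>s\<close> only weakens
  the bound.\<close>

lemma slope_after_peak_ge:
  assumes t: "s \<le> t" "t < b"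
  shows "- ((lam + w s powr (4 / m)) * w s * t / (m + 2)) \<le> w' t"
proof -
  let ?B = "(lam + w s powr (4 / m)) * w s"
  let ?J = "\<lambda>t. t ^ (m + 1) * w' t + ?B * t ^ (m + 2) / (m + 2)"
  have "?J s \<le> ?J t"
  proof (rule DERIV_nonneg_imp_nondecreasing[where f = ?J])
    fix x assume x: "s \<le> x" "x \<le> t"
    then have xb: "a < x" "x < b" and x0: "0 < x" using s t a_nonneg by auto
    have "(?J has_real_derivative - (x ^ (m + 1) * (lam * w x + w x powr (4 / m) * w x))
        + ?B * (real (m + 2) * x ^ (m + 1)) / (m + 2)) (at x)"
      using DERIV_pow[of "m + 2" x UNIV]
      by (intro DERIV_add DERIV_cdivide DERIV_cmult flux_deriv xb) simp
    moreover have "(lam + w x powr (4 / m)) * w x \<le> ?B"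
      using max[of x] xb pos[OF xb] lam_pos
      by (intro mult_mono add_left_mono powr_mono2 add_nonneg_nonneg) auto
    then have "x ^ (m + 1) * ((lam + w x powr (4 / m)) * w x) \<le> x ^ (m + 1) * ?B"
      using x0 by (intro mult_left_mono) auto
    moreover have "?B * (real (m + 2) * x ^ (m + 1)) / (m + 2) = x ^ (m + 1) * ?B"
      by simp
    ultimately show "\<exists>d. (?J has_real_derivative d) (at x) \<and> 0 \<le> d"
      by (intro exI[of _ "- (x ^ (m + 1) * (lam * w x + w x powr (4 / m) * w x)) + ?B * (real (m + 2) * x ^ (m + 1)) / (m + 2)"] conjI)
      (simp_all add: algebra_simps)
  qed (use t in simp)
  moreover have "0 \<le> ?J s"
    using peak peak_pos lam_pos s a_nonneg by (auto intro!: mult_nonneg_nonneg add_nonneg_nonneg)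
  ultimately have "0 \<le> t ^ (m + 1) * (w' t + ?B * t / (m + 2))"
    by (simp add: algebra_simps)
  moreover have "0 < t ^ (m + 1)" using t s a_nonneg by simp
  ultimately show ?thesis
    by (simp only: zero_le_mult_iff) linarith
qed

text \<open>The profile falls from \<open>w s\<close> to \<open>0\<close> before radius
  \<open>1\<close>, with slope limited by \<open>slope_after_peak_ge\<close>. Integration makes
  \<open>w s\<close> at most \<open>(lam + w s powr (4 / m)) * w s / (2 * (m + 2))\<close>, and
  \<open>w s\<close> cancels.\<close>

lemma peak_height:
  assumes wb: "w b = 0" and b1: "b \<le> 1"
  shows "2 * (real m + 2) - lam \<le> w s powr (4 / m)"
proof -
  let ?B = "(lam + w s powr (4 / m)) * w s"
  have B: "0 \<le> ?B" using peak_pos lam_pos by (intro mult_nonneg_nonneg add_nonneg_nonneg) auto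
  let ?J = "\<lambda>t. w t + ?B * t\<^sup>2 / (2 * (real m + 2))"
  have "?J s \<le> ?J b"
  proof (rule DERIV_nonneg_imp_le_open[where f = ?J])
    show "continuous_on {s..b} ?J"
      using s by (intro continuous_intros continuous_on_subset[OF cont]) auto
    fix x assume x: "s < x" "x < b"
    then have xb: "a < x" "x < b" using s by auto
    have "(?J has_real_derivative w' x + ?B * (2 * x) / (2 * (real m + 2))) (at x)"
      using DERIV_pow[of 2 x UNIV] by (intro DERIV_add DERIV_cdivide DERIV_cmult deriv xb) simp
    moreover have "?B * (2 * x) / (2 * (real m + 2)) = ?B * x / (real m + 2)"
      using mult_divide_mult_cancel_left[of 2 "?B * x" "real m + 2"] by (simp only: mult.left_commute)
    moreover have "- (?B * x / (real m + 2)) \<le> w' x"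
      using slope_after_peak_ge[of x] x by (simp add: add.commute)
    ultimately show "\<exists>d. (?J has_real_derivative d) (at x) \<and> 0 \<le> d"
      by - (rule exI, rule conjI, assumption, simp)
  qed (use s in simp)
  moreover have "0 \<le> ?B * s\<^sup>2 / (2 * (real m + 2))" using B by simp
  moreover have "?B * b\<^sup>2 / (2 * (real m + 2)) \<le> ?B / (2 * (real m + 2))"
    using b1 a_less_b a_nonneg B power_mono[of b 1 2]
    by (intro divide_right_mono mult_left_le) auto
  ultimately have "w s * 1 \<le> w s * ((lam + w s powr (4 / m)) / (2 * (real m + 2)))"
    using wb by (simp add: mult.commute)
  then have "1 \<le> (lam + w s powr (4 / m)) / (2 * (real m + 2))"
    using peak_pos by (simp only: mult_le_cancel_left_pos)
  then show ?thesis
    by (simp add: field_simps)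
qed

text \<open>With \<open>s\<close> replaced by \<open>0\<close> the left-hand side would be that of
  the bubble of height \<open>w s\<close>. The term in \<open>s\<close> is the price of starting
  both integrations at the peak.\<close>

lemma decay_after_peak:
  assumes t: "s \<le> t" "t < b"
  shows "1 + w s powr (4 / m) * (t\<^sup>2 - (real m + 2) / m * s\<^sup>2) / (m * (real m + 2))
    \<le> (w t / w s) powr (- (2 / m))"
proof -
  define n where "n = real m + 2"
  define k where "k = real m"
  define Z where "Z = w s powr (2 / m)"
  have k0: "0 < k" using m_ge by (simp add: k_def)
  have n0: "0 < n" by (simp add: n_def)
  have Z0: "0 < Z" using peak_pos by (simp add: Z_def)
  have ZZ: "Z * Z = w s powr (4 / m)"
    by (simp add: Z_def flip: powr_add)
  have s0: "0 < s" using s a_nonneg by simp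
  have range: "a < x" "x < b" "0 < x" if "s \<le> x" "x \<le> t" for x
    using that s t a_nonneg by auto
  define E where "E = (\<lambda>t. w t powr (- (2 / m)))"
  have E_pos: "0 < E x" if "s \<le> x" "x \<le> t" for x
    using pos[OF range(1,2)[OF that]] by (simp add: E_def)
  have E_deriv: "(E has_real_derivative - (2 / m) * E x / w x * w' x) (at x)" if "s \<le> x" "x \<le> t" for x
    unfolding E_def using range[OF that] by (intro has_real_derivative_powr_of_pos deriv pos)
  \<comment> \<open>With this \<open>c\<close> the terms in \<open>(w y)^2\<close> cancel in the
    derivative of \<open>pohozaev c\<close>, leaving a multiple of \<open>- w y * w' y\<close>,
    which is nonnegative after the peak. It is also the coefficient produced by
    \<open>quotient_identity\<close>.\<close>
  define c where "c = lam * k / n"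
  define G0 where "G0 = s ^ (m + 2) * (k / (2 * n) * (w s powr (4 / m) * (w s)\<^sup>2))"
  have G: "G0 \<le> pohozaev c x" if x: "s \<le> x" "x \<le> t" for x
  proof -
    have "G0 \<le> pohozaev c s"
      using peak lam_pos s0 unfolding pohozaev_def G0_def n_def k_def c_def
      by (simp add: distrib_left)
    also have "pohozaev c s \<le> pohozaev c x"
    proof (rule DERIV_nonneg_imp_nondecreasing[where f = "pohozaev c"])
      fix y assume y: "s \<le> y" "y \<le> x"
      then have yt: "s \<le> y" "y \<le> t" "y < b" using x t by auto
      note yr = range[OF yt(1,2)]
      have c_lam: "(c - lam) / 2 = - (lam / n)"
        using n0 unfolding c_def by (simp add: field_simps n_def k_def)
      have "lam * y ^ (m + 1) * (w y)\<^sup>2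
          + (c - lam) / 2 * ((real m + 2) * y ^ (m + 1) * (w y)\<^sup>2 + 2 * y ^ (m + 2) * w y * w' y)
        = - (2 * lam / n * y ^ (m + 2) * w y * w' y)"
        unfolding c_lam n_def[symmetric] using n0 by (simp add: field_simps)
      moreover have "2 * lam / n * y ^ (m + 2) * w y * w' y \<le> 0"
        using slope_nonpos_after_peak[OF yt(1,3)] pos[OF yr(1,2)] yr(3) n0 lam_pos
        by (intro mult_nonneg_nonpos) auto
      ultimately show "\<exists>d. (pohozaev c has_real_derivative d) (at y) \<and> 0 \<le> d"
        by - (rule exI, rule conjI, rule pohozaev_deriv[OF yr(1,2)], linarith)
    qed (use x in simp)
    finally show ?thesis .
  qed
  \<comment> \<open>\<open>Q x\<close> is the derivative of \<open>E\<close> divided by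
    \<open>x\<close>. It is constant for the bubble and vanishes at the peak.\<close>
  define Q where "Q = (\<lambda>x. - (2 / k) * E x * w' x / (w x * x))"
  have Q_ge: "2 * Z / (k * n) * (1 - s ^ (m + 2) / x ^ (m + 2)) \<le> Q x" if x: "s \<le> x" "x \<le> t" for x
  proof -
    \<comment> \<open>The added term has derivative
      \<open>- 2 * Z * s ^ (m + 2) / (k * x ^ (m + 3))\<close>, minus the lower bound for the
      derivative of \<open>Q\<close> that follows from \<open>G0\<close>.\<close>
    let ?P = "\<lambda>x. Q x + 2 * Z * s ^ (m + 2) / (k * n) * (1 / x ^ (m + 2))"
    have "?P s \<le> ?P x"
    proof (rule DERIV_nonneg_imp_nondecreasing[where f = ?P])
      fix y assume y: "s \<le> y" "y \<le> x"
      then have yt: "s \<le> y" "y \<le> t" "y < b" using x t by auto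
      note yr = range[OF yt(1,2)] and wy = pos[OF range(1,2)[OF yt(1,2)]]
      let ?X = "- (real m + 1) / y * w' y - lam * w y - w y powr (4 / m) * w y"
      have "(Q has_real_derivative
          ((- (2 / k) * (- (2 / m) * E y / w y * w' y) * w' y + ?X * (- (2 / k) * E y)) * (w y * y)
            - (- (2 / k) * E y * w' y) * (w' y * y + 1 * w y)) / ((w y * y) * (w y * y))) (at y)"
        unfolding Q_def using wy yr(3)
        by (intro DERIV_divide DERIV_mult DERIV_cmult E_deriv yt deriv deriv2 yr DERIV_ident) auto
      moreover have "((\<lambda>x. 1 / x ^ (m + 2)) has_real_derivative - n / y ^ (m + 3)) (at y)"
        proof -
        have "((\<lambda>x. 1 / x ^ (m + 2)) has_real_derivative
            (0 * y ^ (m + 2) - 1 * (real (m + 2) * y ^ (m + 1))) / (y ^ (m + 2) * y ^ (m + 2))) (at y)"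
          using DERIV_pow[of "m + 2" y UNIV] yr(3) by (intro DERIV_divide DERIV_const) auto
        moreover have "(0 * y ^ (m + 2) - 1 * (real (m + 2) * y ^ (m + 1))) / (y ^ (m + 2) * y ^ (m + 2)) = - n / y ^ (m + 3)"
          using yr(3) by (simp add: n_def power_add power2_eq_square power3_eq_cube divide_simps)
        ultimately show ?thesis by metis
      qed
      moreover have "((- (2 / k) * (- (2 / m) * E y / w y * w' y) * w' y + ?X * (- (2 / k) * E y)) * (w y * y)
            - (- (2 / k) * E y * w' y) * (w' y * y + 1 * w y)) / ((w y * y) * (w y * y))
         = 4 * n / k\<^sup>2 * (E y / (w y)\<^sup>2) / y ^ (m + 3) * pohozaev c y"
        proof -
        have X: "y * ?X = - (k + 1) * w' y - y * (lam * w y + w y powr (4 / m) * w y)"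
          using yr(3) by (simp add: k_def field_simps)
        have P: "pohozaev c y = y ^ m * y\<^sup>2 * (w' y)\<^sup>2 / 2 + k / 2 * (y ^ m * y) * w y * w' y
            + y ^ m * y\<^sup>2 * (k / (2 * n) * (w y powr (4 / m) * (w y)\<^sup>2) + lam * k / n / 2 * (w y)\<^sup>2)"
          by (simp add: pohozaev_def c_def k_def n_def power2_eq_square mult_ac)
        have "k \<noteq> 0" "w y \<noteq> 0" "y \<noteq> 0" "y ^ m \<noteq> 0" "n = k + 2" "n \<noteq> 0"
          using k0 n0 wy yr(3) by (auto simp: n_def k_def)
        from quotient_identity[OF this X, of "E y", unfolded k_def] show ?thesis
          unfolding P power_add k_def .
      qed
      moreover have "2 * Z * s ^ (m + 2) / (k * n) * (n / y ^ (m + 3))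
         \<le> 4 * n / k\<^sup>2 * (E y / (w y)\<^sup>2) / y ^ (m + 3) * pohozaev c y"
        proof -
        \<comment> \<open>Both \<open>E y\<close> and \<open>1 / (w y)^2\<close> are smallest at the
          peak, where \<open>w\<close> is largest; since \<open>Z * Z\<close> equals
          \<open>w s powr (4 / m)\<close>, the bound with \<open>G0\<close> collapses to a multiple
          of \<open>Z\<close>.\<close>
        have "1 / Z \<le> E y"
          using max[of y] yr wy m_ge unfolding Z_def E_def powr_minus_divide[symmetric]
          by (intro powr_mono2') auto
        moreover have "(w y)\<^sup>2 \<le> (w s)\<^sup>2"
          using max[of y] yr wy by (intro power_mono) auto
        ultimately have "1 / Z / (w s)\<^sup>2 \<le> E y / (w y)\<^sup>2"
          using wy Z0 E_pos[OF yt(1,2)] by (intro frac_le) auto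
        moreover have "0 \<le> G0"
          using s0 k0 n0 by (simp add: G0_def)
        moreover have "0 \<le> 1 / Z / (w s)\<^sup>2" using Z0 by simp
        ultimately have "1 / Z / (w s)\<^sup>2 * G0 \<le> E y / (w y)\<^sup>2 * pohozaev c y"
          using G[OF yt(1,2)] E_pos[OF yt(1,2)] by (intro mult_mono) auto
        then have "4 * n / k\<^sup>2 / y ^ (m + 3) * (1 / Z / (w s)\<^sup>2 * G0)
            \<le> 4 * n / k\<^sup>2 / y ^ (m + 3) * (E y / (w y)\<^sup>2 * pohozaev c y)"
          using n0 k0 yr(3) by (intro mult_left_mono) auto
        also have "1 / Z / (w s)\<^sup>2 * G0 = s ^ (m + 2) * k / (2 * n) * Z"
          using Z0 peak_pos n0 unfolding G0_def ZZ[symmetric] by (simp add: field_simps)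
        also have "4 * n / k\<^sup>2 / y ^ (m + 3) * (s ^ (m + 2) * k / (2 * n) * Z)
           = 2 * Z * s ^ (m + 2) / (k * n) * (n / y ^ (m + 3))"
          using k0 n0 by (simp add: field_simps power2_eq_square)
        also have "4 * n / k\<^sup>2 / y ^ (m + 3) * (E y / (w y)\<^sup>2 * pohozaev c y)
           = 4 * n / k\<^sup>2 * (E y / (w y)\<^sup>2) / y ^ (m + 3) * pohozaev c y"
          by (simp add: mult_ac)
        finally show ?thesis .
      qed
      ultimately show "\<exists>d. (?P has_real_derivative d) (at y) \<and> 0 \<le> d"
        by - (rule exI, rule conjI, rule DERIV_add, assumption, rule DERIV_cmult, assumption, simp)
    qed (use x in simp)
    moreover have "Q s = 0" by (simp add: Q_def peak)
    ultimately show ?thesis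
      using s0 by (simp add: right_diff_distrib)
  qed
  \<comment> \<open>The subtracted bracket is an antiderivative of
    \<open>x * (1 - s ^ (m + 2) / x ^ (m + 2))\<close>, from the bound on \<open>Q\<close>.\<close>
  let ?R = "\<lambda>x. E x - 2 * Z / (k * n) * (x\<^sup>2 / 2 + s ^ (m + 2) / k * (1 / x ^ m))"
  have R: "?R s \<le> ?R t"
  proof (rule DERIV_nonneg_imp_nondecreasing[where f = ?R])
    fix x assume x: "s \<le> x" "x \<le> t"
    show "\<exists>d. (?R has_real_derivative d) (at x) \<and> 0 \<le> d"
      proof -
      note xr = range[OF x]
      have "((\<lambda>x. 1 / x ^ m) has_real_derivative - k / x ^ (m + 1)) (at x)"
      proof -
        have "((\<lambda>x. 1 / x ^ m) has_real_derivative
            (0 * x ^ m - 1 * (real m * x ^ (m - 1))) / (x ^ m * x ^ m)) (at x)"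
          using DERIV_pow[of m x UNIV] xr(3) by (intro DERIV_divide DERIV_const) auto
        moreover have "x ^ m = x * x ^ (m - 1)"
          using m_ge by (simp flip: power_Suc)
        then have "(0 * x ^ m - 1 * (real m * x ^ (m - 1))) / (x ^ m * x ^ m) = - k / x ^ (m + 1)"
          using xr(3) by (simp add: k_def divide_simps)
        ultimately show ?thesis by metis
      qed
      then have "(?R has_real_derivative (- (2 / m) * E x / w x * w' x
          - 2 * Z / (k * n) * (2 * x / 2 + s ^ (m + 2) / k * (- k / x ^ (m + 1))))) (at x)"
        using DERIV_pow[of 2 x UNIV]
        by (intro DERIV_diff DERIV_add DERIV_cmult DERIV_cdivide E_deriv x) simp
      moreover have "2 * Z / (k * n) * (2 * x / 2 + s ^ (m + 2) / k * (- k / x ^ (m + 1)))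
         \<le> - (2 / m) * E x / w x * w' x"
      proof -
        have "2 * Z / (k * n) * (2 * x / 2 + s ^ (m + 2) / k * (- k / x ^ (m + 1)))
           = x * (2 * Z / (k * n) * (1 - s ^ (m + 2) / x ^ (m + 2)))"
          using xr(3) k0 by (simp add: algebra_simps)
        also have "\<dots> \<le> x * Q x"
          using Q_ge[OF x] xr(3) by (intro mult_left_mono) auto
        also have "x * Q x = - (2 / m) * E x / w x * w' x"
          using xr(3) by (simp add: Q_def k_def)
        finally show ?thesis .
      qed
      ultimately show ?thesis
        by - (rule exI, rule conjI, assumption, simp only: diff_ge_0_iff_ge)
    qed
  qed (use t in simp)
  have Es: "E s = 1 / Z"
    by (simp add: E_def Z_def powr_minus_divide)
  have ss: "s ^ (m + 2) / k * (1 / s ^ m) = s\<^sup>2 / k"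
    using s0 by (simp add: power_add power2_eq_square)
  \<comment> \<open>The contribution of the inverse power at \<open>t\<close> is dropped; at
    \<open>s\<close> it equals \<open>s^2 / k\<close> and turns the coefficient of
    \<open>s^2\<close> into \<open>1 + 2 / k = n / k\<close>.\<close>
  have nn: "0 \<le> s ^ (m + 2) / k * (1 / t ^ m)"
    using s0 k0 range[OF t(1)] by simp
  have "1 / Z + 2 * Z / (k * n) * ((t\<^sup>2 / 2) - (s\<^sup>2 / 2 + s\<^sup>2 / k)) \<le> E t"
    proof -
    define A where "A = 2 * Z / (k * n)"
    have "0 < A" using Z0 k0 n0 by (simp add: A_def)
    have "1 / Z + A * ((t\<^sup>2 / 2) - (s\<^sup>2 / 2 + s\<^sup>2 / k)) \<le> E t"
      if "1 / Z - A * (s\<^sup>2 / 2 + s\<^sup>2 / k) \<le> E t - A * (t\<^sup>2 / 2 + r)" "0 \<le> r" for r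
    proof -
      have "0 \<le> A * r" using that(2) \<open>0 < A\<close> by simp
      with that(1) show ?thesis unfolding distrib_left right_diff_distrib by linarith
    qed
    from this[OF _ nn] show ?thesis
      using R unfolding A_def[symmetric] Es ss .
  qed
  then have main: "Z * (1 / Z + 2 * Z / (k * n) * ((t\<^sup>2 / 2) - (s\<^sup>2 / 2 + s\<^sup>2 / k))) \<le> Z * E t"
    using Z0 by simp
  have e1: "(t\<^sup>2 / 2) - (s\<^sup>2 / 2 + s\<^sup>2 / k) = (t\<^sup>2 - n / k * s\<^sup>2) / 2"
    using k0 by (simp add: field_simps n_def k_def)
  have e2: "Z * (1 / Z + 2 * Z / (k * n) * (X / 2)) = 1 + Z * Z * X / (k * n)" for X
    using Z0 by (simp add: distrib_left)
  have e3: "Z * E t = (w t / w s) powr (- (2 / m))"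
    using pos[of t] peak_pos s t unfolding Z_def E_def
    by (simp add: powr_divide powr_minus field_simps)
  show ?thesis
    using main unfolding e1 e2 ZZ e3 unfolding n_def k_def .
qed

end

end

section \<open>Radial functions and the Laplacian\<close>

lemma gradient_eqI:
  assumes "(f has_derivative (\<lambda>h. h \<bullet> D)) (at x)"
  shows "gradient f x = D"
  unfolding gradient_def
proof (rule the_equality)
  show "GDERIV f x :> D"
    using assms by (simp add: gderiv_def)
  fix D' assume "GDERIV f x :> D'"
  then have "(\<lambda>h. h \<bullet> D') = (\<lambda>h. h \<bullet> D)"
    using has_derivative_unique[OF _ assms] unfolding gderiv_def by blast
  then show "D' = D"
    by (simp add: fun_eq_iff vector_eq_ldot)
qed

lemma has_derivative_gradient:
  fixes f :: "real^'n \<Rightarrow> real"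
  assumes "f differentiable (at x)"
  shows "(f has_derivative (\<lambda>h. h \<bullet> gradient f x)) (at x)"
proof -
  obtain f' where f': "(f has_derivative f') (at x)"
    using assms by (auto simp: differentiable_def)
  then have "linear f'"
    by (rule has_derivative_linear)
  then have "f' = (\<lambda>h. h \<bullet> adjoint f' 1)"
    by (auto simp: adjoint_works)
  with f' gradient_eqI show ?thesis
    by metis
qed

lemma trace_jacobian:
  assumes "(G has_derivative G') (at x)"
  shows "trace (jacobian G (at x)) = (\<Sum>i\<in>UNIV. G' (axis i 1) $ i)"
  using frechet_derivative_at[OF assms] by (simp add: trace_def jacobian_def matrix_def)

context
  fixes u :: "real^'n \<Rightarrow> real" and e :: "real^'n"
  assumes radial: "radial u" and C2: "C2_on (ball 0 1) u" and e: "norm e = 1"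
begin

lemma radial_profile_deriv:
  assumes "\<bar>t\<bar> < 1"
  shows "((\<lambda>t. u (t *\<^sub>R e)) has_real_derivative gradient u (t *\<^sub>R e) \<bullet> e) (at t)"
proof -
  have "u differentiable (at (t *\<^sub>R e))"
    using C2 assms e by (simp add: C2_on_def)
  then have "((\<lambda>t. u (t *\<^sub>R e)) has_derivative (\<lambda>h. (h *\<^sub>R e) \<bullet> gradient u (t *\<^sub>R e))) (at t)"
    by (intro has_derivative_compose[where g = u and f = "\<lambda>t. t *\<^sub>R e"] has_derivative_gradient)
       (auto intro!: derivative_eq_intros)
  then show ?thesis
    by (rule has_derivative_imp_has_field_derivative) (simp add: inner_commute)
qed

text \<open>Away from the origin the norm is differentiable and \<open>u\<close> is its profile
  composed with the norm. The resulting form, a scalar function of the norm times the position, can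
  be differentiated once more.\<close>

lemma gradient_radial:
  assumes x: "norm x < 1" "x \<noteq> 0"
  shows "gradient u x = (gradient u (norm x *\<^sub>R e) \<bullet> e / norm x) *\<^sub>R x"
proof (rule gradient_eqI)
  let ?g = "gradient u (norm x *\<^sub>R e) \<bullet> e"
  have "((\<lambda>t. u (t *\<^sub>R e)) has_derivative (\<lambda>h. ?g * h)) (at (norm x))"
    using radial_profile_deriv[of "norm x"] x by (simp add: has_field_derivative_def)
  from has_derivative_compose[where g = "\<lambda>t. u (t *\<^sub>R e)", OF has_derivative_norm[OF x(2)] this]
  have "((\<lambda>y. u (norm y *\<^sub>R e)) has_derivative (\<lambda>h. h \<bullet> (?g / norm x) *\<^sub>R x)) (at x)"
    by (simp add: sgn_div_norm inner_commute mult_ac divide_inverse)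
  then show "(u has_derivative (\<lambda>h. h \<bullet> (?g / norm x) *\<^sub>R x)) (at x)"
  proof (rule has_derivative_transform_within_open[where s = "ball 0 1"])
    fix y :: "real^'n" assume "y \<in> ball 0 1"
    then show "u (norm y *\<^sub>R e) = u y"
      using radial e unfolding radial_def by auto
  qed (use x in auto)
qed

text \<open>The interval includes \<open>0\<close> because the integrations on the inner ball start
  there.\<close>

lemma continuous_on_radial_slope: "continuous_on {0..<1} (\<lambda>t. gradient u (t *\<^sub>R e) \<bullet> e)"
proof -
  have "continuous_on (ball 0 1) (gradient u)"
    using C2 unfolding C2_on_def
    by (auto intro!: continuous_at_imp_continuous_on differentiable_imp_continuous_within)
  moreover have "continuous_on {0..<1} (\<lambda>t. t *\<^sub>R e)"
    by (intro continuous_intros)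
  moreover have "(\<lambda>t. t *\<^sub>R e) ` {0..<1} \<subseteq> ball 0 1"
    by (auto simp: e)
  ultimately have "continuous_on {0..<1} (\<lambda>t. gradient u (t *\<^sub>R e))"
    by (rule continuous_on_compose2)
  then show ?thesis
    by (rule continuous_on_inner) (rule continuous_on_const)
qed

lemma radial_slope_deriv:
  assumes t: "0 < t" "t < 1"
  shows "((\<lambda>t. gradient u (t *\<^sub>R e) \<bullet> e) has_real_derivative
    laplacian u (t *\<^sub>R e) - (real CARD('n) - 1) / t * (gradient u (t *\<^sub>R e) \<bullet> e)) (at t)"
proof -
  define \<psi> where "\<psi> = (\<lambda>t. gradient u (t *\<^sub>R e) \<bullet> e)"
  have "gradient u differentiable (at (t *\<^sub>R e))"
    using C2 t e by (simp add: C2_on_def)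
  then obtain G' where G': "(gradient u has_derivative G') (at (t *\<^sub>R e))"
    by (auto simp: differentiable_def)
  interpret G': linear G'
    using G' by (rule has_derivative_linear)
  have "((\<lambda>t. gradient u (t *\<^sub>R e)) has_derivative (\<lambda>h. G' (h *\<^sub>R e))) (at t)"
    by (rule has_derivative_compose[where f = "\<lambda>t. t *\<^sub>R e" and g = "gradient u"])
       (use G' in \<open>auto intro!: derivative_eq_intros\<close>)
  then have "(\<psi> has_derivative (\<lambda>h. G' (h *\<^sub>R e) \<bullet> e)) (at t)"
    unfolding \<psi>_def by (auto intro!: derivative_eq_intros)
  then obtain p where p: "(\<psi> has_real_derivative p) (at t)"
    using has_derivative_imp_has_field_derivative[of \<psi> _ _ "G' e \<bullet> e"] by (auto simp: G'.scaleR)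
  \<comment> \<open>\<open>kd\<close> is the derivative of \<open>\<psi> t / t\<close>. As the
    gradient at \<open>y\<close> is \<open>\<psi> (norm y) / norm y\<close> times \<open>y\<close>,
    its Jacobian is a multiple of the identity plus a rank-one term, whose trace can be read
    off.\<close>
  define kd where "kd = (p * t - \<psi> t) / t\<^sup>2"
  have kd: "((\<lambda>t. \<psi> t / t) has_derivative (\<lambda>h. kd * h)) (at t)"
    unfolding kd_def using t
    by (auto intro!: derivative_eq_intros p[unfolded has_field_derivative_def]
          simp: power2_eq_square field_simps)
  have nx: "norm (t *\<^sub>R e) = t" and x0: "t *\<^sub>R e \<noteq> 0"
    using t e by auto
  have "((\<lambda>y. \<psi> (norm y) / norm y) has_derivative (\<lambda>h. kd * (h \<bullet> sgn (t *\<^sub>R e)))) (at (t *\<^sub>R e))"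
    using has_derivative_compose[where g = "\<lambda>t. \<psi> t / t" and g' = "\<lambda>h. kd * h", OF has_derivative_norm[OF x0]] kd t e
    by (simp add: inner_commute)
  then have "((\<lambda>y. (\<psi> (norm y) / norm y) *\<^sub>R y) has_derivative
      (\<lambda>h. (\<psi> t / t) *\<^sub>R h + (kd * (h \<bullet> sgn (t *\<^sub>R e))) *\<^sub>R (t *\<^sub>R e))) (at (t *\<^sub>R e))"
    by (rule has_derivative_eq_rhs[OF has_derivative_scaleR[OF _ has_derivative_ident]]) (use t e in simp)
  then have "(gradient u has_derivative
      (\<lambda>h. (\<psi> t / t) *\<^sub>R h + (kd * (h \<bullet> sgn (t *\<^sub>R e))) *\<^sub>R (t *\<^sub>R e))) (at (t *\<^sub>R e))"
    by (rule has_derivative_transform_within_open[where s = "ball 0 1 - {0}"])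
       (use gradient_radial t e in \<open>auto simp: \<psi>_def\<close>)
  then have "laplacian u (t *\<^sub>R e) = (\<Sum>i\<in>UNIV. \<psi> t / t + kd * t * (e $ i)\<^sup>2)"
    unfolding laplacian_def hessian_def
    by (subst trace_jacobian, assumption)
       (use t e in \<open>simp add: inner_axis' sgn_div_norm power2_eq_square mult_ac\<close>)
  also have "\<dots> = real CARD('n) * (\<psi> t / t) + kd * t * (\<Sum>i\<in>UNIV. (e $ i)\<^sup>2)"
    by (simp add: sum.distrib sum_distrib_left)
  also have "(\<Sum>i\<in>UNIV. (e $ i)\<^sup>2) = 1"
    using e by (simp add: norm_eq_sqrt_inner inner_vec_def power2_eq_square)
  moreover have "kd * t = p - \<psi> t / t"
    unfolding kd_def using t by (simp add: power2_eq_square field_simps)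
  ultimately have "p = laplacian u (t *\<^sub>R e) - (real CARD('n) - 1) / t * \<psi> t"
    by (simp add: left_diff_distrib diff_divide_distrib)
  with p show ?thesis
    unfolding \<psi>_def by simp
qed

end

section \<open>The first Dirichlet eigenvalue of the ball\<close>

lemma second_derivative_nonpos_at_max:
  fixes g g' :: "real \<Rightarrow> real"
  assumes d: "0 < d" and g: "\<And>t. \<bar>t\<bar> < d \<Longrightarrow> (g has_real_derivative g' t) (at t)"
    and max: "\<And>t. \<bar>t\<bar> < d \<Longrightarrow> g t \<le> g 0" and D: "(g' has_real_derivative D) (at 0)"
  shows "D \<le> 0"
proof (rule ccontr)
  assume "\<not> D \<le> 0"
  then obtain d' where d': "0 < d'" and inc: "\<And>h. 0 < h \<Longrightarrow> h < d' \<Longrightarrow> g' 0 < g' h"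
    using DERIV_pos_inc_right[OF D] by auto
  have "g' 0 = 0"
    using DERIV_local_max[OF g[of 0] d] d max by simp
  define h where "h = min d d' / 2"
  have h: "0 < h" "h < d" "h < d'"
    using d d' by (auto simp: h_def)
  have "g 0 < g h"
  proof (rule DERIV_pos_imp_increasing_open[OF h(1)])
    show "\<exists>y. (g has_real_derivative y) (at x) \<and> 0 < y" if "0 < x" "x < h" for x
      using g[of x] inc[of x] that h \<open>g' 0 = 0\<close> by auto
    show "continuous_on {0..h} g"
      using h by (intro continuous_at_imp_continuous_on ballI DERIV_isCont[OF g]) auto
  qed
  then show False
    using max[of h] h by simp
qed

text \<open>The second derivatives along the coordinate axes are nonpositive at the maximum and are
  summed. The factor \<open>c\<close> allows a change of sign, and the paraboloid has Laplacian
  \<open>2 * k * CARD('n)\<close>.\<close>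

lemma laplacian_at_max:
  fixes f :: "real^'n \<Rightarrow> real"
  assumes S: "open S" and C2: "C2_on S f" and x: "x \<in> S"
    and max: "\<And>y. y \<in> S \<Longrightarrow> c * f y + k * (norm y)\<^sup>2 \<le> c * f x + k * (norm x)\<^sup>2"
  shows "c * laplacian f x + 2 * k * CARD('n) \<le> 0"
proof -
  obtain d where d: "0 < d" "ball x d \<subseteq> S"
    using S x open_contains_ball by blast
  obtain G' where G': "(gradient f has_derivative G') (at x)"
    using C2 x by (auto simp: C2_on_def differentiable_def)
  interpret G': linear G'
    using G' by (rule has_derivative_linear)
  have "c * (G' (axis i 1) $ i) + 2 * k \<le> 0" for i
  proof -
    let ?b = "axis i 1 :: real^'n"
    let ?g = "\<lambda>t. c * f (x + t *\<^sub>R ?b) + k * ((x + t *\<^sub>R ?b) \<bullet> (x + t *\<^sub>R ?b))"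
    let ?g' = "\<lambda>t. c * (gradient f (x + t *\<^sub>R ?b) \<bullet> ?b) + k * (2 * (x \<bullet> ?b) + 2 * t)"
    have in_S: "x + t *\<^sub>R ?b \<in> S" if "\<bar>t\<bar> < d" for t
      using that d(2) by (auto simp: dist_norm)
    have sq: "(x + t *\<^sub>R ?b) \<bullet> (x + t *\<^sub>R ?b) = x \<bullet> x + 2 * t * (x \<bullet> ?b) + t\<^sup>2" for t
      by (simp add: inner_add inner_commute power2_eq_square inner_axis_axis)
    show ?thesis
    proof (rule second_derivative_nonpos_at_max[OF d(1)])
      fix t assume t: "\<bar>t\<bar> < d"
      have "f differentiable (at (x + t *\<^sub>R ?b))"
        using in_S[OF t] C2 by (auto simp: C2_on_def)
      then have "((\<lambda>t. f (x + t *\<^sub>R ?b)) has_derivative (\<lambda>h. (h *\<^sub>R ?b) \<bullet> gradient f (x + t *\<^sub>R ?b))) (at t)"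
        by (intro has_derivative_compose[where g = f and f = "\<lambda>t. x + t *\<^sub>R ?b"] has_derivative_gradient)
           (auto intro!: derivative_eq_intros)
      then have "((\<lambda>t. f (x + t *\<^sub>R ?b)) has_real_derivative gradient f (x + t *\<^sub>R ?b) \<bullet> ?b) (at t)"
        by (rule has_derivative_imp_has_field_derivative) (simp add: inner_commute)
      moreover have "((\<lambda>t. x \<bullet> x + 2 * t * (x \<bullet> ?b) + t\<^sup>2) has_real_derivative 2 * (x \<bullet> ?b) + 2 * t) (at t)"
        by (auto intro!: derivative_eq_intros)
      ultimately show "(?g has_real_derivative ?g' t) (at t)"
        unfolding sq by (rule DERIV_add[OF DERIV_cmult DERIV_cmult])
      show "?g t \<le> ?g 0"
        using max[OF in_S[OF t]] by (simp add: power2_norm_eq_inner)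
    next
      have "((\<lambda>t. gradient f (x + t *\<^sub>R ?b)) has_derivative (\<lambda>h. G' (h *\<^sub>R ?b))) (at 0)"
        by (rule has_derivative_compose[where g = "gradient f" and f = "\<lambda>t. x + t *\<^sub>R ?b"])
           (use G' in \<open>auto intro!: derivative_eq_intros\<close>)
      then have "((\<lambda>t. gradient f (x + t *\<^sub>R ?b) \<bullet> ?b) has_derivative (\<lambda>h. G' (h *\<^sub>R ?b) \<bullet> ?b)) (at 0)"
        by (rule has_derivative_inner_left)
      then have "((\<lambda>t. gradient f (x + t *\<^sub>R ?b) \<bullet> ?b) has_real_derivative G' ?b $ i) (at 0)"
        by (rule has_derivative_imp_has_field_derivative) (simp add: G'.scaleR inner_axis)
      moreover have "((\<lambda>t. 2 * (x \<bullet> ?b) + 2 * t) has_real_derivative 2) (at 0)"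
        by (auto intro!: derivative_eq_intros)
      ultimately have "(?g' has_real_derivative c * (G' ?b $ i) + k * 2) (at 0)"
        by (rule DERIV_add[OF DERIV_cmult DERIV_cmult])
      then show "(?g' has_real_derivative c * (G' ?b $ i) + 2 * k) (at 0)"
        by (simp add: mult.commute)
    qed
  qed
  then have "(\<Sum>i\<in>UNIV. c * (G' (axis i 1) $ i) + 2 * k) \<le> 0"
    by (rule sum_nonpos)
  then show ?thesis
    by (simp add: laplacian_def hessian_def trace_jacobian[OF G'] sum.distrib sum_distrib_left mult_ac)
qed

text \<open>Let \<open>m\<close> be the maximum of the eigenfunction with its sign fixed. Adding
  \<open>m / 2 * (norm y)^2\<close> keeps the boundary values at \<open>m / 2\<close>, below the new
  maximum, which is therefore interior. There the Laplacian test gives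
  \<open>m * CARD('n) \<le> \<mu> * m\<close>.\<close>

lemma dirichlet_eigenvalue_ge:
  assumes "dirichlet_eigenvalue (ball 0 1 :: (real^'n) set) \<mu>"
  shows "real CARD('n) \<le> \<mu>"
proof -
  obtain \<phi> :: "real^'n \<Rightarrow> real" and x where
    \<phi>: "dirichlet_solution (ball 0 1) (\<lambda>t. \<mu> * t) \<phi>" and x: "x \<in> ball 0 1" "\<phi> x \<noteq> 0"
    using assms unfolding dirichlet_eigenvalue_def by blast
  define c where "c = sgn (\<phi> x)"
  have cont: "continuous_on (cball 0 1) \<phi>" and C2: "C2_on (ball 0 1) \<phi>"
    and eq: "\<And>y. norm y < 1 \<Longrightarrow> - laplacian \<phi> y = \<mu> * \<phi> y" and bd: "\<And>y. norm y = 1 \<Longrightarrow> \<phi> y = 0"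
    using \<phi> by (auto simp: dirichlet_solution_def)
  have "\<exists>x0\<in>cball 0 1. \<forall>y\<in>cball 0 1. c * \<phi> y \<le> c * \<phi> x0"
    by (rule continuous_attains_sup) (auto intro!: continuous_intros cont)
  then obtain x0 where x0: "norm x0 \<le> 1" and max0: "\<And>y. norm y \<le> 1 \<Longrightarrow> c * \<phi> y \<le> c * \<phi> x0"
    by auto
  define m where "m = c * \<phi> x0"
  have "0 < c * \<phi> x"
    using x(2) by (auto simp: c_def sgn_if)
  then have m: "0 < m"
    using max0[of x] x(1) by (simp add: m_def)
  let ?f = "\<lambda>y. c * \<phi> y + m / 2 * (norm y)\<^sup>2"
  have "\<exists>x1\<in>cball 0 1. \<forall>y\<in>cball 0 1. ?f y \<le> ?f x1"
    by (rule continuous_attains_sup) (auto intro!: continuous_intros cont)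
  then obtain x1 where x1: "norm x1 \<le> 1" and max1: "\<And>y. norm y \<le> 1 \<Longrightarrow> ?f y \<le> ?f x1"
    by auto
  have f_x1: "m \<le> ?f x1"
  proof -
    have "0 \<le> m / 2 * (norm x0)\<^sup>2" using m by simp
    then show ?thesis using max1[OF x0] unfolding m_def[symmetric] by linarith
  qed
  have x1': "norm x1 < 1"
  proof (rule ccontr)
    assume "\<not> norm x1 < 1"
    then have "norm x1 = 1" using x1 by simp
    then show False using f_x1 bd m by simp
  qed
  have "c * laplacian \<phi> x1 + 2 * (m / 2) * CARD('n) \<le> 0"
    using max1 x1' by (intro laplacian_at_max[OF open_ball C2]) (auto simp: less_imp_le)
  moreover have "laplacian \<phi> x1 = - (\<mu> * \<phi> x1)"
    using eq[OF x1'] by simp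
  ultimately have le: "m * CARD('n) \<le> \<mu> * (c * \<phi> x1)"
    by (simp add: mult_ac)
  \<comment> \<open>Positivity of \<open>c * \<phi> x1\<close> comes first: it forces
    \<open>\<mu>\<close> to be positive, and only then may \<open>c * \<phi> x1\<close> be replaced
    by its upper bound \<open>m\<close>.\<close>
  have "(norm x1)\<^sup>2 \<le> 1"
    using x1 by (simp add: power_le_one)
  then have "m / 2 * (norm x1)\<^sup>2 \<le> m / 2"
    using m by (simp add: mult_left_le)
  then have p: "0 < c * \<phi> x1"
    using f_x1 m by linarith
  have "0 < m * CARD('n)" using m by simp
  then have "0 < \<mu>"
    using le p by (metis less_le_trans zero_less_mult_pos2)
  then have "\<mu> * (c * \<phi> x1) \<le> \<mu> * m"
    using max0[OF x1] by (simp add: m_def)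
  with le have "m * CARD('n) \<le> m * \<mu>"
    by (simp add: mult.commute)
  then show ?thesis
    using m by simp
qed

section \<open>Existence of an eigenvalue from a radial power series\<close>

lemma bessel_type_equation_has_zero:
  fixes f f' f'' :: "real \<Rightarrow> real"
  assumes f: "\<And>z. 0 < z \<Longrightarrow> (f has_real_derivative f' z) (at z)"
    and f': "\<And>z. 0 < z \<Longrightarrow> (f' has_real_derivative f'' z) (at z)"
    and ode: "\<And>z. 0 < z \<Longrightarrow> 4 * z * f'' z + 2 * \<nu> * f' z + f z = 0"
  shows "\<exists>z>0. f z = 0"
proof (rule ccontr)
  assume "\<not> ?thesis"
  then have nz: "f z \<noteq> 0" if "0 < z" for z
    using that by blast
  define b where "b = \<nu> / 2 - 1"
  \<comment> \<open>Without a zero of \<open>f\<close>, this logarithmic derivative satisfies a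
    Riccati equation on the whole half-line; its solutions blow up at a finite point.\<close>
  define Y where "Y = (\<lambda>z. - z * f' z / f z)"
  have Y: "(Y has_real_derivative 1 / 4 + ((Y z)\<^sup>2 - b * Y z) / z) (at z)" if z: "0 < z" for z
  proof -
    have "f'' z * - z = (2 * \<nu> * f' z + f z) / 4"
      using ode[OF z] by (simp add: field_simps)
    then have "((- 1 * f' z + f'' z * - z) * f z - - z * f' z * f' z) / (f z * f z)
       = ((- 1 * f' z + (2 * \<nu> * f' z + f z) / 4) * f z - - z * f' z * f' z) / (f z * f z)"
      by simp
    also have "\<dots> = 1 / 4 + ((Y z)\<^sup>2 - b * Y z) / z"
      using z nz[OF z] by (simp add: Y_def b_def power2_eq_square field_simps)
    finally have "((- 1 * f' z + f'' z * - z) * f z - - z * f' z * f' z) / (f z * f z)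
       = 1 / 4 + ((Y z)\<^sup>2 - b * Y z) / z" .
    moreover have "(Y has_real_derivative ((- 1 * f' z + f'' z * - z) * f z - - z * f' z * f' z) / (f z * f z)) (at z)"
      unfolding Y_def by (intro DERIV_divide DERIV_mult DERIV_minus DERIV_ident f f' z nz)
    ultimately show ?thesis by simp
  qed
  \<comment> \<open>Completing the square bounds \<open>Y^2 - b * Y\<close> below by
    \<open>- b^2 / 4\<close>; beyond \<open>z0\<close> this costs at most \<open>1 / 8\<close> of
    the source \<open>1 / 4\<close>, so \<open>Y\<close> grows at least linearly.\<close>
  define z0 where "z0 = max 1 (2 * b\<^sup>2)"
  have growth: "Y z0 + (z - z0) / 8 \<le> Y z" if z: "z0 \<le> z" for z
  proof -
    have "Y z0 - z0 / 8 \<le> Y z - z / 8"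
    proof (rule DERIV_nonneg_imp_nondecreasing[OF z])
      fix x assume x: "z0 \<le> x" "x \<le> z"
      have x0: "0 < x" "2 * b\<^sup>2 \<le> x" using x by (auto simp: z0_def)
      have "- b\<^sup>2 / 4 \<le> (Y x)\<^sup>2 - b * Y x"
        using zero_le_power2[of "Y x - b / 2"] by (simp add: power2_eq_square algebra_simps)
      then have "(- b\<^sup>2 / 4) / x \<le> ((Y x)\<^sup>2 - b * Y x) / x"
        using x0 by (intro divide_right_mono) auto
      moreover have "- (1 / 8) \<le> (- b\<^sup>2 / 4) / x"
        using x0 by (simp add: field_simps)
      ultimately have "0 \<le> 1 / 4 + ((Y x)\<^sup>2 - b * Y x) / x - 1 / 8"
        by simp
      moreover have "((\<lambda>x. Y x - x / 8) has_real_derivative 1 / 4 + ((Y x)\<^sup>2 - b * Y x) / x - 1 / 8) (at x)"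
        by (intro DERIV_diff Y x0 DERIV_cdivide DERIV_ident)
      ultimately show "\<exists>y. ((\<lambda>x. Y x - x / 8) has_real_derivative y) (at x) \<and> 0 \<le> y"
        by blast
    qed
    then show ?thesis by (simp add: field_simps)
  qed
  \<comment> \<open>Once \<open>Y\<close> exceeds \<open>2 * b\<close>, the quadratic term is at
    least \<open>Y^2 / 2\<close>, so that \<open>- 1 / Y\<close> grows at least as fast as
    \<open>ln z / 2\<close>.\<close>
  define K where "K = max 1 (2 * b)"
  define z1 where "z1 = z0 + 8 * (\<bar>K\<bar> + \<bar>Y z0\<bar>)"
  have z1: "z0 \<le> z1" "0 < z1" by (auto simp: z1_def z0_def K_def)
  have Y_ge: "K \<le> Y z" if "z1 \<le> z" for z
  proof -
    have "\<bar>K\<bar> + \<bar>Y z0\<bar> \<le> (z - z0) / 8"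
      using that by (simp add: z1_def)
    then show ?thesis using growth[of z] that z1 by linarith
  qed
  have K: "1 \<le> K" "2 * b \<le> K" by (auto simp: K_def)
  \<comment> \<open>At this point \<open>ln z / 2\<close> has grown by exactly
    \<open>1 / Y z1\<close>, so \<open>- 1 / Y z2\<close> would have to be nonnegative.\<close>
  define z2 where "z2 = z1 * exp (2 / Y z1)"
  have z12: "z1 \<le> z2"
    using z1 K Y_ge[of z1] by (simp add: z2_def)
  have "- 1 / Y z1 - ln z1 / 2 \<le> - 1 / Y z2 - ln z2 / 2"
  proof (rule DERIV_nonneg_imp_nondecreasing[OF z12])
    fix x assume x: "z1 \<le> x" "x \<le> z2"
    have x0: "0 < x" using x z1 by simp
    have Yx: "1 \<le> Y x" "2 * b \<le> Y x" using Y_ge[OF x(1)] K by auto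
    have "Y x / 2 * Y x \<le> (Y x - b) * Y x"
      using Yx by (intro mult_right_mono) auto
    then have "((Y x)\<^sup>2 / 2) / x \<le> ((Y x)\<^sup>2 - b * Y x) / x"
      using x0 by (intro divide_right_mono) (auto simp: power2_eq_square algebra_simps)
    then have "(Y x)\<^sup>2 / (2 * x) \<le> 1 / 4 + ((Y x)\<^sup>2 - b * Y x) / x"
      by simp
    then have "((Y x)\<^sup>2 / (2 * x)) / (Y x)\<^sup>2 \<le> (1 / 4 + ((Y x)\<^sup>2 - b * Y x) / x) / (Y x)\<^sup>2"
      by (intro divide_right_mono) auto
    then have "0 \<le> (1 / 4 + ((Y x)\<^sup>2 - b * Y x) / x) / (Y x)\<^sup>2 - 1 / x / 2"
      using Yx by simp
    moreover have "((\<lambda>x. - 1 / Y x - ln x / 2) has_real_derivative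
        (1 / 4 + ((Y x)\<^sup>2 - b * Y x) / x) / (Y x)\<^sup>2 - 1 / x / 2) (at x)"
      using Yx x0 by (auto intro!: derivative_eq_intros Y simp: power2_eq_square diff_divide_distrib add_divide_distrib)
    ultimately show "\<exists>y. ((\<lambda>x. - 1 / Y x - ln x / 2) has_real_derivative y) (at x) \<and> 0 \<le> y"
      by blast
  qed
  moreover have "ln z2 = ln z1 + 2 * (1 / Y z1)"
    using z1 by (simp add: z2_def ln_mult)
  moreover have "0 < 1 / Y z2"
    using Y_ge[OF z12] K by simp
  ultimately show False
    unfolding minus_divide_left[symmetric] by linarith
qed

text \<open>The coefficients of \<open>\<Gamma>(\<nu>/2) (t/2)\<^bsup>1-\<nu>/2\<^esup> J\<^bsub>\<nu>/2-1\<^esub>(t)\<close> as a power series in \<open>t\<^sup>2\<close>.\<close>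
primrec bessel_coeff :: "real \<Rightarrow> nat \<Rightarrow> real" where
  "bessel_coeff \<nu> 0 = 1"
| "bessel_coeff \<nu> (Suc k) = - bessel_coeff \<nu> k / ((k + 1) * (4 * k + 2 * \<nu>))"

text \<open>Since \<open>4 * k + 2 * \<nu>\<close> is at least \<open>2 * \<nu>\<close>, the
  exponential series in \<open>\<bar>z\<bar> / (2 * \<nu>)\<close> dominates.\<close>

lemma bessel_coeff_summable:
  assumes "0 < \<nu>"
  shows "summable (\<lambda>k. bessel_coeff \<nu> k * z ^ k)"
proof (rule summable_comparison_test')
  show "summable (\<lambda>k. inverse (fact k) * (\<bar>z\<bar> / (2 * \<nu>)) ^ k)"
    by (rule summable_exp)
  have "\<bar>bessel_coeff \<nu> k\<bar> \<le> inverse (fact k) * (1 / (2 * \<nu>)) ^ k" for k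
  proof (induction k)
    case (Suc k)
    have "\<bar>bessel_coeff \<nu> (Suc k)\<bar> = \<bar>bessel_coeff \<nu> k\<bar> * (1 / ((k + 1) * (4 * k + 2 * \<nu>)))"
      using assms by (simp add: abs_mult)
    also have "\<dots> \<le> inverse (fact k) * (1 / (2 * \<nu>)) ^ k * (1 / ((k + 1) * (2 * \<nu>)))"
      using assms by (intro mult_mono Suc.IH divide_left_mono mult_left_mono mult_pos_pos) auto
    also have "\<dots> = inverse (fact (Suc k)) * (1 / (2 * \<nu>)) ^ Suc k"
      using assms by (simp add: field_simps)
    finally show ?case .
  qed simp
  then show "norm (bessel_coeff \<nu> k * z ^ k) \<le> inverse (fact k) * (\<bar>z\<bar> / (2 * \<nu>)) ^ k" if "k \<ge> 0" for k
    using mult_right_mono[of "\<bar>bessel_coeff \<nu> k\<bar>" "inverse (fact k) * (1 / (2 * \<nu>)) ^ k" "\<bar>z\<bar> ^ k"]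
    by (simp add: abs_mult power_abs power_divide)
qed

text \<open>This is the radial eigenvalue equation in the variable
  \<open>z = \<mu> * (x \<bullet> x)\<close>. In that variable the solution is entire, which makes
  the eigenfunction smooth at the origin as well.\<close>

lemma bessel_series_solution:
  fixes \<nu> :: real
  assumes \<nu>: "0 < \<nu>"
  obtains f f' f'' :: "real \<Rightarrow> real" where
    "f 0 = 1" "\<And>z. (f has_real_derivative f' z) (at z)" "\<And>z. (f' has_real_derivative f'' z) (at z)"
    "\<And>z. isCont f'' z" "\<And>z. 4 * z * f'' z + 2 * \<nu> * f' z + f z = 0"
proof -
  let ?c = "bessel_coeff \<nu>"
  define f where "f = (\<lambda>z. \<Sum>k. ?c k * z ^ k)"
  define f' where "f' = (\<lambda>z. \<Sum>k. diffs ?c k * z ^ k)"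
  define f'' where "f'' = (\<lambda>z. \<Sum>k. diffs (diffs ?c) k * z ^ k)"
  have s0: "summable (\<lambda>k. ?c k * z ^ k)" for z
    by (rule bessel_coeff_summable[OF \<nu>])
  have s1: "summable (\<lambda>k. diffs ?c k * z ^ k)" for z
    by (rule termdiff_converges_all[OF s0])
  have s2: "summable (\<lambda>k. diffs (diffs ?c) k * z ^ k)" for z
    by (rule termdiff_converges_all[OF s1])
  show thesis
  proof (rule that)
    show "f 0 = 1"
      using powser_zero[of ?c] by (simp add: f_def)
    show "(f has_real_derivative f' z) (at z)" for z
      unfolding f_def f'_def by (rule termdiffs_strong_converges_everywhere[OF s0])
    show "(f' has_real_derivative f'' z) (at z)" for z
      unfolding f'_def f''_def by (rule termdiffs_strong_converges_everywhere[OF s1])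
    show "isCont f'' z" for z
      unfolding f''_def by (rule isCont_powser_converges_everywhere[OF s2])
    show "4 * z * f'' z + 2 * \<nu> * f' z + f z = 0" for z
    proof -
      have "(\<lambda>k. z * (diffs (diffs ?c) k * z ^ k)) sums (z * f'' z)"
        unfolding f''_def by (intro sums_mult summable_sums s2)
      then have "(\<lambda>k. real (Suc k) * diffs ?c (Suc k) * z ^ Suc k) sums (z * f'' z)"
        by (simp add: diffs_def[of "diffs ?c"] mult_ac)
      \<comment> \<open>The shift back to index \<open>k\<close> needs no correction, since the term
        at \<open>0\<close> carries the factor \<open>real 0\<close>.\<close>
      then have "(\<lambda>k. real k * diffs ?c k * z ^ k) sums (z * f'' z)"
        by (subst (asm) sums_Suc_iff) simp
      from sums_add[OF sums_add[OF sums_mult[OF this, of 4] sums_mult[OF summable_sums[OF s1], of "2 * \<nu>" z]]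
          summable_sums[OF s0, of z]]
      have "(\<lambda>k. 4 * (real k * diffs ?c k * z ^ k) + 2 * \<nu> * (diffs ?c k * z ^ k) + ?c k * z ^ k)
        sums (4 * z * f'' z + 2 * \<nu> * f' z + f z)"
        by (simp add: f_def f'_def mult.assoc)
      moreover have "4 * (real k * diffs ?c k * z ^ k) + 2 * \<nu> * (diffs ?c k * z ^ k) + ?c k * z ^ k = 0" for k
      proof -
        have "(4 * real k + 2 * \<nu>) * diffs ?c k = - ?c k"
          using \<nu> by (simp add: diffs_def field_simps add_nonneg_eq_0_iff)
        then have "((4 * real k + 2 * \<nu>) * diffs ?c k + ?c k) * z ^ k = 0"
          by simp
        then show ?thesis by (simp add: algebra_simps)
      qed
      ultimately show ?thesis
        by (simp add: sums_iff)
    qed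
  qed
qed

lemma dirichlet_eigenvalue_exists: "\<exists>\<mu>. dirichlet_eigenvalue (ball 0 1 :: (real^'n) set) \<mu>"
proof -
  obtain f f' f'' :: "real \<Rightarrow> real" where f0: "f 0 = 1"
    and f: "\<And>z. (f has_real_derivative f' z) (at z)"
    and f': "\<And>z. (f' has_real_derivative f'' z) (at z)"
    and f'': "\<And>z. isCont f'' z"
    and ode: "\<And>z. 4 * z * f'' z + 2 * real CARD('n) * f' z + f z = 0"
    using bessel_series_solution[of "real CARD('n)"] by auto
  \<comment> \<open>The zero of \<open>f\<close> serves twice: scaling by \<open>\<mu>\<close> makes
    it the eigenvalue, and on the unit sphere the argument of \<open>f\<close> is
    \<open>\<mu>\<close>, which gives the boundary condition.\<close>
  obtain \<mu> where \<mu>: "0 < \<mu>" "f \<mu> = 0"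
    using bessel_type_equation_has_zero[OF f f' ode] by blast
  define \<phi> where "\<phi> = (\<lambda>x :: real^'n. f (\<mu> * (x \<bullet> x)))"
  have q: "((\<lambda>x :: real^'n. \<mu> * (x \<bullet> x)) has_derivative (\<lambda>h. 2 * \<mu> * (x \<bullet> h))) (at x)" for x
    by (auto intro!: derivative_eq_intros simp: inner_commute)
  have D\<phi>: "(\<phi> has_derivative (\<lambda>h. h \<bullet> (2 * \<mu> * f' (\<mu> * (x \<bullet> x))) *\<^sub>R x)) (at x)" for x
    unfolding \<phi>_def
    using has_derivative_compose[where g = f, OF q f[unfolded has_field_derivative_def], of x]
    by (simp add: inner_commute mult_ac)
  then have grad: "gradient \<phi> x = (2 * \<mu> * f' (\<mu> * (x \<bullet> x))) *\<^sub>R x" for x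
    by (rule gradient_eqI)
  have Dgrad: "(gradient \<phi> has_derivative (\<lambda>h. (2 * \<mu> * f' (\<mu> * (x \<bullet> x))) *\<^sub>R h
      + (4 * \<mu>\<^sup>2 * f'' (\<mu> * (x \<bullet> x)) * (x \<bullet> h)) *\<^sub>R x)) (at x)" for x
  proof -
    have "((\<lambda>x :: real^'n. 2 * \<mu> * f' (\<mu> * (x \<bullet> x))) has_derivative
        (\<lambda>h. 4 * \<mu>\<^sup>2 * f'' (\<mu> * (x \<bullet> x)) * (x \<bullet> h))) (at x)"
      using has_derivative_mult_right[OF has_derivative_compose[where g = f', OF q f'[unfolded has_field_derivative_def]], of "2 * \<mu>" x]
      by (simp add: power2_eq_square mult_ac)
    then show ?thesis
      unfolding grad[abs_def] by (rule has_derivative_scaleR[OF _ has_derivative_ident])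
  qed
  have hess: "hessian \<phi> x = (\<chi> i j. 2 * \<mu> * f' (\<mu> * (x \<bullet> x)) * axis j 1 $ i
      + 4 * \<mu>\<^sup>2 * f'' (\<mu> * (x \<bullet> x)) * (x $ j) * (x $ i))" for x
    unfolding hessian_def jacobian_def frechet_derivative_at[OF Dgrad, symmetric]
    by (simp add: matrix_def vec_eq_iff inner_axis)
  have lap: "laplacian \<phi> x = - (\<mu> * \<phi> x)" for x
  proof -
    have "laplacian \<phi> x = 2 * \<mu> * f' (\<mu> * (x \<bullet> x)) * CARD('n) + 4 * \<mu>\<^sup>2 * f'' (\<mu> * (x \<bullet> x)) * (x \<bullet> x)"
    proof -
      define A B where "A = 2 * \<mu> * f' (\<mu> * (x \<bullet> x))" and "B = 4 * \<mu>\<^sup>2 * f'' (\<mu> * (x \<bullet> x))"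
      have "laplacian \<phi> x = (\<Sum>i\<in>UNIV. A + B * (x $ i * x $ i))"
        unfolding laplacian_def trace_def hess A_def[symmetric] B_def[symmetric] by (simp add: mult.assoc)
      also have "\<dots> = A * CARD('n) + B * (\<Sum>i\<in>UNIV. x $ i * x $ i)"
        by (simp add: sum.distrib sum_distrib_left)
      finally show ?thesis
        unfolding A_def B_def inner_vec_def by simp
    qed
    also have "\<dots> = \<mu> * (4 * (\<mu> * (x \<bullet> x)) * f'' (\<mu> * (x \<bullet> x)) + 2 * real CARD('n) * f' (\<mu> * (x \<bullet> x)))"
      by (simp add: power2_eq_square algebra_simps)
    also have "4 * (\<mu> * (x \<bullet> x)) * f'' (\<mu> * (x \<bullet> x)) + 2 * real CARD('n) * f' (\<mu> * (x \<bullet> x)) = - \<phi> x"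
      using ode[of "\<mu> * (x \<bullet> x)"] by (simp add: \<phi>_def)
    finally show ?thesis by simp
  qed
  have "continuous_on UNIV (hessian \<phi>)"
  proof -
    have cf': "continuous_on UNIV f'" "continuous_on UNIV f''"
      by (intro continuous_at_imp_continuous_on ballI DERIV_isCont[OF f'] f'')+
    show ?thesis
      unfolding hess[abs_def]
      by (intro continuous_on_vec_lambda continuous_intros continuous_on_compose2[OF cf'(1)] continuous_on_compose2[OF cf'(2)])
         auto
  qed
  then have "C2_on (ball 0 1) \<phi>"
    using D\<phi> Dgrad unfolding C2_on_def differentiable_def by (blast intro: continuous_on_subset)
  moreover have "continuous_on (closure (ball 0 1)) \<phi>"
    using D\<phi> has_derivative_continuous by (blast intro: continuous_at_imp_continuous_on)
  moreover have "\<phi> x = 0" if "x \<in> frontier (ball 0 1)" for x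
    using that \<mu> by (simp add: \<phi>_def flip: power2_norm_eq_inner)
  ultimately have "dirichlet_solution (ball 0 1) (\<lambda>t. \<mu> * t) \<phi>"
    using lap by (simp add: dirichlet_solution_def)
  moreover have "\<phi> 0 \<noteq> 0"
    using f0 by (simp add: \<phi>_def)
  ultimately show ?thesis
    unfolding dirichlet_eigenvalue_def by (metis centre_in_ball zero_less_one)
qed

text \<open>The infimum of an empty set of reals says nothing, so an eigenvalue must exist before
  the lower bound passes to the infimum.\<close>

lemma first_dirichlet_eigenvalue_pos: "0 < first_dirichlet_eigenvalue (ball 0 1 :: (real^'n) set)"
proof -
  have "real CARD('n) \<le> first_dirichlet_eigenvalue (ball 0 1 :: (real^'n) set)"
    unfolding first_dirichlet_eigenvalue_def
    using dirichlet_eigenvalue_exists dirichlet_eigenvalue_ge by (intro cInf_greatest) auto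
  then show ?thesis
    by (meson less_le_trans of_nat_0_less_iff zero_less_card_finite)
qed

section \<open>The rescaled negative part\<close>

text \<open>The nonlinearity is odd, so the sign \<open>c\<close> covers both nodal regions:
  \<open>1\<close> in the inner ball and \<open>- 1\<close> in the annulus.\<close>

lemma radial_solution_profile:
  fixes u :: "real^'n \<Rightarrow> real" and e :: "real^'n"
  defines "m \<equiv> CARD('n) - 2"
  assumes dim: "4 \<le> CARD('n)" and lam: "0 < lam" and e: "norm e = 1"
    and sol: "brezis_nirenberg_solution lam u" and radial: "radial u"
    and c: "\<bar>c\<bar> = 1" and ab: "0 \<le> a" "a < b" "b \<le> 1"
    and pos: "\<And>t. a < t \<Longrightarrow> t < b \<Longrightarrow> 0 < c * u (t *\<^sub>R e)"
  shows "critical_radial_profile m lam a b (\<lambda>t. c * u (t *\<^sub>R e)) (\<lambda>t. c * (gradient u (t *\<^sub>R e) \<bullet> e))"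
proof
  have cont: "continuous_on (cball 0 1) u" and C2: "C2_on (ball 0 1) u"
    and eq: "\<And>x. norm x < 1 \<Longrightarrow>
      - laplacian u x = lam * u x + \<bar>u x\<bar> powr (critical_exponent CARD('n) - 2) * u x"
    using sol by (auto simp: brezis_nirenberg_solution_def dirichlet_solution_def)
  show "2 \<le> m" "0 < lam" "0 \<le> a" "a < b"
    using dim lam ab by (auto simp: m_def)
  show "continuous_on {a..b} (\<lambda>t. c * u (t *\<^sub>R e))"
    by (intro continuous_intros continuous_on_compose2[OF cont]) (use ab e in auto)
  fix t assume t: "a < t" "t < b"
  show "0 < c * u (t *\<^sub>R e)"
    by (rule pos[OF t])
  show "((\<lambda>t. c * u (t *\<^sub>R e)) has_real_derivative c * (gradient u (t *\<^sub>R e) \<bullet> e)) (at t)"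
    by (intro DERIV_cmult radial_profile_deriv[OF radial C2 e]) (use t ab in auto)
  have exponent: "critical_exponent CARD('n) - 2 = 4 / m"
    using dim by (simp add: critical_exponent_def m_def of_nat_diff field_simps)
  have abs: "\<bar>u (t *\<^sub>R e)\<bar> = c * u (t *\<^sub>R e)"
    using pos[OF t] c by (metis abs_mult abs_of_pos mult_1)
  have lap: "laplacian u (t *\<^sub>R e) = - lam * u (t *\<^sub>R e) - (c * u (t *\<^sub>R e)) powr (4 / m) * u (t *\<^sub>R e)"
    using eq[of "t *\<^sub>R e"] t ab e unfolding exponent abs by simp
  have "((\<lambda>t. c * (gradient u (t *\<^sub>R e) \<bullet> e)) has_real_derivative
      c * (laplacian u (t *\<^sub>R e) - (real CARD('n) - 1) / t * (gradient u (t *\<^sub>R e) \<bullet> e))) (at t)"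
    by (intro DERIV_cmult radial_slope_deriv[OF radial C2 e]) (use t ab in auto)
  moreover have n: "real CARD('n) - 1 = real m + 1"
    using dim by (simp add: m_def of_nat_diff)
  moreover have "c * (- lam * v - K * v - N / t * g) = - N / t * (c * g) - lam * (c * v) - K * (c * v)" for v K N g
    by (simp add: right_diff_distrib mult_ac)
  ultimately show "((\<lambda>t. c * (gradient u (t *\<^sub>R e) \<bullet> e)) has_real_derivative
      - (real m + 1) / t * (c * (gradient u (t *\<^sub>R e) \<bullet> e)) - lam * (c * u (t *\<^sub>R e))
        - (c * u (t *\<^sub>R e)) powr (4 / m) * (c * u (t *\<^sub>R e))) (at t)"
    unfolding lap n by (simp only:)
qed

text \<open>The exponent \<open>2 * (m + 2) / m\<close> is the dimension times the rescaling
  exponent \<open>2 / m\<close>, so the radius estimate bounds the \<open>m + 2\<close>-nd power of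
  the rescaled peak radius. The disjunct \<open>1 < norm x\<close> appears because a solution is
  constrained only in the closed ball.\<close>

lemma peak_radius_bound:
  fixes u :: "real^'n \<Rightarrow> real" and e :: "real^'n"
  defines "m \<equiv> CARD('n) - 2"
  assumes dim: "4 \<le> CARD('n)" and lam: "0 < lam" "lam \<le> 1" and e: "norm e = 1"
    and sol: "brezis_nirenberg_solution lam u" and radial: "radial u" and node: "is_node u r"
  obtains s where "r < s" "s < 1" "\<And>x. neg_part u x \<le> - u (s *\<^sub>R e) \<or> 1 < norm x"
    "0 < - u (s *\<^sub>R e)"
    "s ^ (m + 2) * (- u (s *\<^sub>R e)) powr (2 * (real m + 2) / m)
       \<le> 2 * (real m + 2) / m * (real m * (real m + 2) / 2) powr (m / 2)"
    "\<And>t. s \<le> t \<Longrightarrow> t < 1 \<Longrightarrow>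
       1 + (- u (s *\<^sub>R e)) powr (4 / m) * (t\<^sup>2 - (real m + 2) / m * s\<^sup>2) / (m * (real m + 2))
         \<le> (u (t *\<^sub>R e) / u (s *\<^sub>R e)) powr (- (2 / m))"
proof -
  have cont: "continuous_on (cball 0 1) u" and C2: "C2_on (ball 0 1) u"
    and bd: "\<And>x. norm x = 1 \<Longrightarrow> u x = 0"
    using sol by (auto simp: brezis_nirenberg_solution_def dirichlet_solution_def)
  have r: "0 < r" "r < 1" and inner: "\<And>x. norm x < r \<Longrightarrow> 0 < u x"
    and outer: "\<And>x. r < norm x \<Longrightarrow> norm x < 1 \<Longrightarrow> u x < 0"
    using node by (auto simp: is_node_def)
  define m' where "m' = real m"
  have m: "2 \<le> m'" using dim by (simp add: m'_def m_def)
  define \<phi> where "\<phi> = (\<lambda>t. u (t *\<^sub>R e))"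
  define \<psi> where "\<psi> = (\<lambda>t. gradient u (t *\<^sub>R e) \<bullet> e)"
  have cont_\<phi>: "continuous_on {0..1} \<phi>"
    unfolding \<phi>_def by (intro continuous_intros continuous_on_compose2[OF cont]) (auto simp: e)
  have cont_\<psi>: "continuous_on {0..<1} \<psi>"
    unfolding \<psi>_def by (rule continuous_on_radial_slope[OF radial C2 e])
  have u_\<phi>: "u x = \<phi> (norm x)" if "norm x \<le> 1" for x
    using radial[unfolded radial_def, rule_format, of x "norm x *\<^sub>R e"] that e by (simp add: \<phi>_def)
  interpret I: critical_radial_profile m lam 0 r "\<lambda>t. 1 * \<phi> t" "\<lambda>t. 1 * \<psi> t"
    unfolding \<phi>_def \<psi>_def m_def
    by (intro radial_solution_profile dim lam e sol radial) (use r inner e in auto)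
  interpret O: critical_radial_profile m lam r 1 "\<lambda>t. (- 1) * \<phi> t" "\<lambda>t. (- 1) * \<psi> t"
    unfolding \<phi>_def \<psi>_def m_def
    by (intro radial_solution_profile dim lam e sol radial) (use r outer e in auto)
  \<comment> \<open>The inner profile and the outer one have opposite signs and are both nonnegative
    at the common end \<open>r\<close>.\<close>
  have \<phi>r: "\<phi> r = 0"
    using I.nonneg[of r] O.nonneg[of r] r by simp
  have \<phi>1: "\<phi> 1 = 0"
    using bd e by (simp add: \<phi>_def)
  have "\<exists>s\<in>{r..1}. \<forall>t\<in>{r..1}. - \<phi> t \<le> - \<phi> s"
    by (rule continuous_attains_sup) (use r in \<open>auto intro!: continuous_intros continuous_on_subset[OF cont_\<phi>]\<close>)
  then obtain s where s': "s \<in> {r..1}" and max: "\<And>t. r \<le> t \<Longrightarrow> t \<le> 1 \<Longrightarrow> - \<phi> t \<le> - \<phi> s"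
    by auto
  define M where "M = - \<phi> s"
  have "0 < - \<phi> ((r + 1) / 2)"
    using O.pos[of "(r + 1) / 2"] r by simp
  then have M: "0 < M"
    using max[of "(r + 1) / 2"] r by (simp add: M_def)
  have s: "r < s" "s < 1"
    using s' M \<phi>r \<phi>1 by (auto simp: M_def less_le)
  have peak: "(- 1) * \<psi> s = 0"
  proof -
    define d where "d = min (s - r) (1 - s)"
    show ?thesis
      by (rule DERIV_local_max[OF O.deriv[OF s], of d]) (use s max in \<open>auto simp: d_def abs_if split: if_splits\<close>)
  qed
  have max': "(- 1) * \<phi> t \<le> (- 1) * \<phi> s" if "r \<le> t" "t \<le> 1" for t
    using max[OF that] by simp
  define C where "C = (real m * (real m + 2) / 2) powr (m / 2)"
  have C: "0 \<le> C" by (simp add: C_def)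
  define p where "p = s ^ (m + 2) * (M powr (4 / m) * M\<^sup>2)"
  have p: "0 \<le> p" using s r M by (simp add: p_def)
  have "p \<le> 2 * (m' + 2) / m' * C"
  proof -
    have 1: "s ^ (m + 2) * (m' / (2 * (m' + 2)) * (M powr (4 / m) * M\<^sup>2))
        \<le> r ^ (m + 2) * (\<psi> r)\<^sup>2 / 2 + lam * M\<^sup>2 * s ^ (m + 2) / (m' + 2)"
      using O.peak_pohozaev[OF s peak max'] \<phi>r continuous_on_subset[OF cont_\<psi>, of "{r..<1}"] r
      by (simp add: M_def m'_def continuous_on_minus add.commute)
    have 2: "r ^ (m + 2) * (\<psi> r)\<^sup>2 \<le> C"
    proof -
      have "continuous_on {0..r} (\<lambda>t. 1 * \<psi> t)"
        unfolding mult_1 by (rule continuous_on_subset[OF cont_\<psi>]) (use r in auto)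
      then have "r ^ (m + 2) * (\<psi> r)\<^sup>2 \<le> lam * C * r\<^sup>2"
        using I.boundary_slope_bound inner[of 0] r \<phi>r by (simp add: C_def \<phi>_def)
      also have "\<dots> \<le> 1 * C * 1"
        using lam r C by (intro mult_mono) (auto simp: power_le_one)
      finally show ?thesis by simp
    qed
    have 3: "lam * M\<^sup>2 * s ^ (m + 2) \<le> p / 7"
    proof -
      \<comment> \<open>The number \<open>7\<close> is the value of \<open>2 * (m + 2) - lam\<close>
        in the worst case \<open>m = 2\<close>, \<open>lam = 1\<close>.\<close>
      have "7 \<le> M powr (4 / m)"
        using O.peak_height[OF s peak max'] \<phi>1 lam m by (simp add: M_def m'_def)
      then have "7 * (M\<^sup>2 * s ^ (m + 2)) \<le> M powr (4 / m) * (M\<^sup>2 * s ^ (m + 2))"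
        using s r by (intro mult_right_mono) auto
      moreover have "lam * (M\<^sup>2 * s ^ (m + 2)) \<le> 1 * (M\<^sup>2 * s ^ (m + 2))"
        using lam s r by (intro mult_right_mono) auto
      ultimately show ?thesis
        by (simp add: p_def mult_ac)
    qed
    have "p * m' / (2 * (m' + 2)) \<le> C / 2 + p / 7 / (m' + 2)"
      using 1 2 divide_right_mono[OF 3, of "m' + 2"] m by (simp add: p_def mult_ac)
    moreover have "p * m' \<le> N * C + 2 / 7 * p" if "p * m' / (2 * N) \<le> C / 2 + p / 7 / N" "0 < N" for N
    proof -
      have "p * m' / (2 * N) * (2 * N) \<le> (C / 2 + p / 7 / N) * (2 * N)"
        using that by (intro mult_right_mono) auto
      moreover have "(C / 2 + p / 7 / N) * (2 * N) = N * C + 2 / 7 * p"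
        using that(2) by (simp add: field_simps)
      ultimately show ?thesis
        using that(2) by simp
    qed
    ultimately have "p * m' \<le> (m' + 2) * C + 2 / 7 * p"
      using m by simp
    \<comment> \<open>This lets the left-hand side absorb \<open>2 / 7 * p\<close>, at the cost of
      the generous factor \<open>2\<close> in the final constant.\<close>
    moreover have "p * 2 \<le> p * m'"
      using m p by (intro mult_left_mono)
    ultimately have "p * m' \<le> 2 * (m' + 2) * C"
      using p by (simp add: algebra_simps)
    then show ?thesis
      using m by (simp add: field_simps)
  qed
  moreover have "M powr (2 * (m' + 2) / m') = M powr (4 / m) * M\<^sup>2"
  proof -
    have "2 * (m' + 2) / m' = 4 / m + 2"
      using m by (simp add: m'_def field_simps)
    then show ?thesis
      using M by (simp add: powr_add powr_numeral)
  qed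
  ultimately have p_bound: "s ^ (m + 2) * M powr (2 * (m' + 2) / m') \<le> 2 * (m' + 2) / m' * C"
    by (simp add: p_def)
  show thesis
  proof (rule that[OF s])
    show "neg_part u x \<le> - u (s *\<^sub>R e) \<or> 1 < norm x" for x
    proof (cases "norm x < r")
      case True
      then show ?thesis
        using inner[OF True] M by (simp add: neg_part_def M_def \<phi>_def)
    next
      case False
      then show ?thesis
        using u_\<phi>[of x] max[of "norm x"] M by (auto simp: neg_part_def M_def \<phi>_def)
    qed
    show "0 < - u (s *\<^sub>R e)"
      using M by (simp add: M_def \<phi>_def)
    show "s ^ (m + 2) * (- u (s *\<^sub>R e)) powr (2 * (real m + 2) / m)
       \<le> 2 * (real m + 2) / m * (real m * (real m + 2) / 2) powr (m / 2)"
      using p_bound by (simp add: M_def \<phi>_def m'_def C_def)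
    show "1 + (- u (s *\<^sub>R e)) powr (4 / m) * (t\<^sup>2 - (real m + 2) / m * s\<^sup>2) / (m * (real m + 2))
         \<le> (u (t *\<^sub>R e) / u (s *\<^sub>R e)) powr (- (2 / m))" if "s \<le> t" "t < 1" for t
      using O.decay_after_peak[OF s peak max' that] by (simp add: \<phi>_def)
  qed
qed

theorem proposition11:
  fixes u :: "real \<Rightarrow> real^'n \<Rightarrow> real"
    and r :: "real \<Rightarrow> real"
    and \<epsilon> :: real
  assumes dim: "7 \<le> CARD('n)"
    and least_energy:
      "\<And>lam. 0 < lam \<Longrightarrow> lam < first_dirichlet_eigenvalue (ball 0 1 :: (real^'n) set) \<Longrightarrow>
          least_energy_radial_sign_changing_solution lam (u lam)"
    and positive_at_0:
      "\<And>lam. 0 < lam \<Longrightarrow> lam < first_dirichlet_eigenvalue (ball 0 1 :: (real^'n) set) \<Longrightarrow>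
          u lam 0 > 0"
    and node:
      "\<And>lam. 0 < lam \<Longrightarrow> lam < first_dirichlet_eigenvalue (ball 0 1 :: (real^'n) set) \<Longrightarrow>
          is_node (u lam) (r lam)"
    and eps: "0 < \<epsilon>" "\<epsilon> < (real CARD('n) - 2) / 2"
  shows "\<exists>h>0. \<exists>lbar>0. lbar \<le> first_dirichlet_eigenvalue (ball 0 1 :: (real^'n) set) \<and>
           (\<forall>lam y. 0 < lam \<and> lam < lbar \<longrightarrow>
              rescaled_neg_part (u lam) (r lam) y \<le> barrier \<epsilon> h y)"
proof -
  have dim4: "4 \<le> CARD('n)" using dim by simp
  define m where "m = CARD('n) - 2"
  define k where "k = real m"
  have k: "5 \<le> k" and n: "real CARD('n) = k + 2"
    using dim by (auto simp: k_def m_def)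
  define c where "c = barrier_coeff CARD('n) \<epsilon>"
  have c: "0 < c" "c < 1"
    using eps k by (auto simp: c_def barrier_coeff_def n field_simps)
  define D where "D = 2 * (real m + 2) / m * (real m * (real m + 2) / 2) powr (m / 2)"
  \<comment> \<open>A bound on the rescaled peak radius itself: if that radius exceeds
    \<open>1\<close>, it is at most its own power, hence at most \<open>D\<close>. No root has to be
    taken.\<close>
  define \<Sigma> where "\<Sigma> = max 1 D"
  \<comment> \<open>With \<open>q \<ge> 1\<close> and \<open>h = \<Sigma> * q\<close>, the loss
    \<open>(k + 2) / k * \<Sigma>^2\<close> equals \<open>(1 - c) * \<Sigma>^2 * q\<close> and stays
    below \<open>(1 - c) * h^2\<close>; again a square root is avoided.\<close>
  define q where "q = (k + 2) / k / (1 - c)"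
  define h where "h = \<Sigma> * q"
  have q1: "1 \<le> q"
  proof -
    have "(1 - c) * k \<le> 1 * k" using c k by (intro mult_right_mono) auto
    then show ?thesis using c k by (simp add: q_def field_simps)
  qed
  have h_ge: "\<Sigma> \<le> h"
    using mult_left_mono[OF q1, of \<Sigma>] by (simp add: h_def \<Sigma>_def)
  have h_sq: "(k + 2) / k * \<Sigma>\<^sup>2 \<le> (1 - c) * h\<^sup>2"
  proof -
    have "(k + 2) / k * \<Sigma>\<^sup>2 = (1 - c) * (\<Sigma>\<^sup>2 * q)"
      using c by (simp add: q_def)
    also have "\<dots> \<le> (1 - c) * (\<Sigma>\<^sup>2 * (q * q))"
      using c q1 by (intro mult_left_mono) auto
    finally show ?thesis by (simp add: h_def power2_eq_square mult_ac)
  qed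
  obtain e :: "real^'n" where e: "norm e = 1"
    using norm_axis_1 by blast
  have bound: "rescaled_neg_part (u lam) (r lam) y \<le> barrier \<epsilon> h y"
    if lam: "0 < lam" "lam < 1" "lam < first_dirichlet_eigenvalue (ball 0 1 :: (real^'n) set)" for lam y
  proof -
    have "brezis_nirenberg_solution lam (u lam)" "radial (u lam)"
      using least_energy[OF lam(1,3)]
      by (auto simp: least_energy_radial_sign_changing_solution_def radial_sign_changing_solution_def)
    note peak = peak_radius_bound[OF dim4 lam(1) less_imp_le[OF lam(2)] e this node[OF lam(1,3)], folded m_def, folded D_def]
    obtain s where s: "r lam < s" "s < 1"
      and max: "\<And>x. neg_part (u lam) x \<le> - u lam (s *\<^sub>R e) \<or> 1 < norm x"
      and M0: "0 < - u lam (s *\<^sub>R e)"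
      and radius: "s ^ (m + 2) * (- u lam (s *\<^sub>R e)) powr (2 * (real m + 2) / m) \<le> D"
      and decay: "\<And>t. s \<le> t \<Longrightarrow> t < 1 \<Longrightarrow>
         1 + (- u lam (s *\<^sub>R e)) powr (4 / m) * (t\<^sup>2 - (real m + 2) / m * s\<^sup>2) / (m * (real m + 2))
           \<le> (u lam (t *\<^sub>R e) / u lam (s *\<^sub>R e)) powr (- (2 / m))"
      by (rule peak) (rule that)
    define M where "M = - u lam (s *\<^sub>R e)"
    have M: "0 < M" using M0 by (simp add: M_def)
    have r: "0 < r lam" and outer: "\<And>x. r lam < norm x \<Longrightarrow> norm x < 1 \<Longrightarrow> u lam x < 0"
      using node[OF lam(1,3)] by (auto simp: is_node_def)
    have s0: "0 < s" using s r by simp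
    \<comment> \<open>The supremum over the open ball is attained there, because
      \<open>s < 1\<close>.\<close>
    have sup: "neg_sup_norm (u lam) = M"
      unfolding neg_sup_norm_def
    proof (rule cSup_eq_maximum)
      have "neg_part (u lam) (s *\<^sub>R e) = M"
        using M by (simp add: neg_part_def M_def)
      then show "M \<in> (\<lambda>x. \<bar>neg_part (u lam) x\<bar>) ` ball 0 1"
        using s s0 e M by (intro image_eqI[where x = "s *\<^sub>R e"]) auto
    next
      fix z assume "z \<in> (\<lambda>x. \<bar>neg_part (u lam) x\<bar>) ` ball 0 1"
      then obtain x :: "real^'n" where x: "norm x < 1" "z = neg_part (u lam) x"
        by (auto simp: neg_part_def)
      then show "z \<le> M"
        using max[of x] by (auto simp: M_def)
    qed
    define S where "S = M powr (2 / k)"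
    have S: "0 < S" using M by (simp add: S_def)
    have S_exp: "M powr rescaling_exponent CARD('n) = S"
      by (simp add: S_def rescaling_exponent_def n)
    have "S * s \<le> \<Sigma>"
    proof -
      have "S ^ (m + 2) = M powr (2 * (k + 2) / k)"
      proof -
        have "S ^ (m + 2) = M powr (real (m + 2) * (2 / k))"
          using M unfolding S_def by (intro powr_power) simp
        then show ?thesis by (simp add: k_def algebra_simps)
      qed
      then have D: "(S * s) ^ (m + 2) \<le> D"
        using radius by (simp add: power_mult_distrib M_def k_def mult_ac del: power_Suc)
      show ?thesis
      proof (cases "S * s \<le> 1")
        case False
        then have "(S * s) ^ 1 \<le> (S * s) ^ (m + 2)"
          by (intro power_increasing) auto
        then show ?thesis using D by (simp add: \<Sigma>_def)
      qed (simp add: \<Sigma>_def)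
    qed
    then have "(S * s)\<^sup>2 \<le> \<Sigma>\<^sup>2"
      using S s0 by (intro power_mono) auto
    have rescaled: "rescaled_neg_part (u lam) (r lam) y
        = (if S * r lam < norm y \<and> norm y < S then 1 / M * neg_part (u lam) (y /\<^sub>R S) else 0)"
      by (simp add: rescaled_neg_part_def Let_def sup S_exp)
    have barrier: "barrier \<epsilon> h y
        = (if norm y \<le> h then 1 else (1 + c * (norm y)\<^sup>2 / (k * (k + 2))) powr (- k / 2))"
      by (simp add: barrier_def Let_def n c_def mult_ac)
    show ?thesis
    proof (cases "S * r lam < norm y \<and> norm y < S")
      case False
      then show ?thesis unfolding rescaled barrier by auto
    next
      case True
      define t where "t = norm y / S"
      define x where "x = y /\<^sub>R S"
      have x: "norm x = t" and t: "r lam < t" "t < 1"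
        using True S by (auto simp: x_def t_def field_simps)
      have y: "norm y = S * t" using S by (simp add: t_def)
      have x_le: "1 / M * neg_part (u lam) x \<le> 1"
        using max[of x] x t M by (simp add: M_def field_simps)
      show ?thesis
      proof (cases "norm y \<le> h")
        case True
        then show ?thesis
          unfolding rescaled barrier x_def[symmetric] using x_le by auto
      next
        case False
        have "u lam x = u lam (t *\<^sub>R e)"
          using \<open>radial (u lam)\<close>[unfolded radial_def, rule_format, of x "t *\<^sub>R e"] x t e r by simp
        then have V: "1 / M * neg_part (u lam) x = u lam (t *\<^sub>R e) / u lam (s *\<^sub>R e)"
          using outer[of x] x t by (simp add: neg_part_def M_def max_def)
        define V where "V = u lam (t *\<^sub>R e) / u lam (s *\<^sub>R e)"
        have V0: "0 < V"
          using outer[of x] x t M0 \<open>u lam x = u lam (t *\<^sub>R e)\<close> by (simp add: V_def divide_neg_neg)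
        \<comment> \<open>Beyond \<open>h\<close> the point lies to the right of the rescaled peak,
          where the decay estimate is available.\<close>
        have "S * s \<le> S * t"
          using False \<open>S * s \<le> \<Sigma>\<close> h_ge y by simp
        then have st: "s \<le> t" using S by simp
        have SS: "M powr (4 / k) = S\<^sup>2"
          using M by (simp add: S_def power2_eq_square flip: powr_add)
        \<comment> \<open>The square of \<open>norm y\<close> is split into the shares
          \<open>c\<close> and \<open>1 - c\<close>; beyond \<open>h\<close> the second share covers
          the loss caused by the peak radius.\<close>
        have "h\<^sup>2 \<le> (norm y)\<^sup>2"
          using False h_ge by (intro power_mono) (auto simp: \<Sigma>_def)
        then have "(1 - c) * h\<^sup>2 \<le> (1 - c) * (norm y)\<^sup>2"
          using c by (intro mult_left_mono) auto
        moreover have "(k + 2) / k * (S * s)\<^sup>2 \<le> (k + 2) / k * \<Sigma>\<^sup>2"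
          using \<open>(S * s)\<^sup>2 \<le> \<Sigma>\<^sup>2\<close> k by (intro mult_left_mono) auto
        ultimately have "c * (norm y)\<^sup>2 \<le> (norm y)\<^sup>2 - (k + 2) / k * (S * s)\<^sup>2"
          using h_sq by (simp add: left_diff_distrib)
        then have "c * (norm y)\<^sup>2 / (k * (k + 2)) \<le> ((norm y)\<^sup>2 - (k + 2) / k * (S * s)\<^sup>2) / (k * (k + 2))"
          using k by (intro divide_right_mono) auto
        also have "\<dots> = S\<^sup>2 * (t\<^sup>2 - (k + 2) / k * s\<^sup>2) / (k * (k + 2))"
          by (simp add: y power_mult_distrib right_diff_distrib mult_ac)
        finally have "1 + c * (norm y)\<^sup>2 / (k * (k + 2)) \<le> V powr (- (2 / k))"
          using decay[OF st t(2)] unfolding V_def[symmetric] k_def[symmetric] M_def[symmetric] SS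
          by linarith
        moreover have "0 < 1 + c * (norm y)\<^sup>2 / (k * (k + 2))"
          using c k by (intro add_pos_nonneg) auto
        \<comment> \<open>The exponent \<open>- k / 2\<close> undoes \<open>- 2 / k\<close>; being
          negative, it reverses the inequality into the upper bound on \<open>V\<close>.\<close>
        ultimately have "(V powr (- (2 / k))) powr (- k / 2) \<le> (1 + c * (norm y)\<^sup>2 / (k * (k + 2))) powr (- k / 2)"
          using k by (intro powr_mono2') auto
        moreover have "(V powr (- (2 / k))) powr (- k / 2) = V"
          using V0 k by (simp add: powr_powr)
        ultimately show ?thesis
          unfolding rescaled barrier x_def[symmetric] V V_def[symmetric] using False True by simp
      qed
    qed
  qed
  show ?thesis
  proof (intro exI conjI allI impI)
    show "0 < h"
      using h_ge by (simp add: \<Sigma>_def)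
    \<comment> \<open>The \<open>1\<close> meets the hypothesis \<open>lam \<le> 1\<close> of the
      peak estimates; the other term keeps \<open>lam\<close> in the range where the family is
      given.\<close>
    show "0 < min 1 (first_dirichlet_eigenvalue (ball 0 1 :: (real^'n) set))"
      using first_dirichlet_eigenvalue_pos by simp
    show "min 1 (first_dirichlet_eigenvalue (ball 0 1 :: (real^'n) set))
        \<le> first_dirichlet_eigenvalue (ball 0 1 :: (real^'n) set)"
      by simp
  qed (auto intro: bound)
qed

end
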